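(* For online one-sided bipartite matching: for every $\epsilon>0$ there exists a max-of-$n^{O(1)}$ algorithm achieving an approximation ratio of $1-1/e-\epsilon$; and no max-of-$2^{o(n)}$ algorithm can achieve an approximation ratio better than $1-1/e+\epsilon$.
   Context: Online one-sided bipartite matching: the bipartite graph has an offline side, whose vertex names are known in advance, and an online side of vertices arriving one at a time in adversarial order; each online vertex arrives together with its set of offline neighbours, and the algorithm must irrevocably either match it to a currently unmatched neighbour or leave it unmatched. The goal is to maximize the matching size; $n$ is the size of the input (number of online vertices), and the algorithm is allowed to know $n$ (non-uniform). A max-of-$k$ algorithm runs $k$ deterministic online algorithms in parallel, building $k$ matchings, and outputs the largest. The approximation ratio is $\inf_I v(\mathbb{A},I)/v(I)$ with $v(I)$ the maximum matching size. *)

theory Defs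
  imports Complex_Main "HOL-Library.Landau_Symbols"
begin

text \<open>Offline vertices are named by natural numbers. An instance is a pair (U, I):
  U is the finite offline vertex set (known in advance), I is the list of online
  vertices in arrival order, each given by its set of offline neighbours.
  The input size n is the number of online vertices, i.e. length I.\<close>

definition valid_instance :: "nat set \<Rightarrow> nat set list \<Rightarrow> bool" where
  "valid_instance U I \<longleftrightarrow> finite U \<and> (\<forall>N \<in> set I. N \<subseteq> U)"

text \<open>A deterministic online algorithm: given the offline set, the neighbour sets of
  the previously arrived online vertices, and the neighbour set of the current online
  vertex, it proposes an offline vertex (or none). Its own earlier decisions are
  determined by these data. A proposal is executed only if it is a currently
  unmatched neighbour; otherwise the vertex stays unmatched.\<close>

type_synonym online_alg = "nat set \<Rightarrow> nat set list \<Rightarrow> nat set \<Rightarrow> nat option"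

fun run_aux :: "online_alg \<Rightarrow> nat set \<Rightarrow> nat set list \<Rightarrow> nat set list \<Rightarrow> nat set \<Rightarrow> nat" where
  "run_aux A U past [] matched = 0"
| "run_aux A U past (N # rest) matched =
     (case A U past N of
        Some u \<Rightarrow> (if u \<in> N \<and> u \<notin> matched
                    then 1 + run_aux A U (past @ [N]) rest (insert u matched)
                    else run_aux A U (past @ [N]) rest matched)
      | None \<Rightarrow> run_aux A U (past @ [N]) rest matched)"

definition alg_value :: "online_alg \<Rightarrow> nat set \<Rightarrow> nat set list \<Rightarrow> nat" where
  "alg_value A U I = run_aux A U [] I {}"

text \<open>A max-of-k algorithm (non-uniform): for every input size n a list of
  deterministic online algorithms (which may depend on n); k(n) is the list length.
  Its value is the largest matching size among them.\<close>
type_synonym max_of_alg = "nat \<Rightarrow> online_alg list"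

definition max_value :: "max_of_alg \<Rightarrow> nat set \<Rightarrow> nat set list \<Rightarrow> nat" where
  "max_value algs U I = Max (insert 0 (set (map (\<lambda>A. alg_value A U I) (algs (length I)))))"

definition is_matching :: "nat set list \<Rightarrow> (nat \<times> nat) set \<Rightarrow> bool" where
  "is_matching I M \<longleftrightarrow> M \<subseteq> {(i, u). i < length I \<and> u \<in> I ! i} \<and> inj_on fst M \<and> inj_on snd M"

definition opt :: "nat set list \<Rightarrow> nat" where
  "opt I = Max {card M | M. is_matching I M}"

definition approx_ratio :: "max_of_alg \<Rightarrow> real" where
  "approx_ratio algs = Inf {real (max_value algs U I) / real (opt I) | U I.
      valid_instance U I \<and> opt I > 0}"

end

theory Submission
  imports
    Defs
    "HOL-Library.FuncSet"
    "HOL-Combinatorics.Multiset_Permutations"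
    "HOL-Real_Asymp.Real_Asymp"
begin

text \<open>
  \<^emph>\<open>Algorithm.\<close> Run Ranking with priorities from a finite set \<open>{..<L}\<close>. The primal-dual
  analysis (a matched edge whose offline endpoint has priority \<open>j\<close> gives the share
  \<open>(1 + 1/L) ^ j / (1 + 1/L) ^ L\<close> to that endpoint and the rest to the online one) shows that the
  average over all priority functions is at least \<open>1 - 1 / (1 + 1/L) ^ L\<close> times the optimum, hence
  a constant fraction \<open>\<delta>\<close> of the priority functions is good for a given instance. Truncating
  neighbourhoods to \<open>n\<close> vertices and renaming offline vertices in order of appearance leaves at
  most \<open>2 ^ (n ^ 3)\<close> instances, so \<open>O(n ^ 3)\<close> greedily chosen priority functions hit all of them.

  \<^emph>\<open>Hardness.\<close> Concatenate many disjoint copies of a block of constant size \<open>B\<close>, in which the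
  neighbourhood starts as the whole block and loses a random vertex in each step. A deterministic
  algorithm gains about \<open>(1 - 1/e) B\<close> per block on average, whatever happened before. So the
  blocks can be fixed one after the other such that the sum of \<open>exp (l * value)\<close> over all
  algorithms grows by at most the average factor; for subexponentially many algorithms this
  bounds the best value.
\<close>

subsection \<open>Matchings and approximation ratio\<close>

lemma is_matching_card_le:
  assumes "is_matching I M"
  shows "finite M" "card M \<le> length I"
proof -
  have sub: "fst ` M \<subseteq> {..<length I}" and inj: "inj_on fst M"
    using assms by (auto simp: is_matching_def)
  show "finite M" using finite_imageD[OF finite_subset[OF sub] inj] by simp
  show "card M \<le> length I"
    using card_mono[OF _ sub] card_image[OF inj] by simp
qed

lemma finite_matching_cards: "finite {card M | M. is_matching I M}"
  by (rule finite_subset[of _ "{..length I}"]) (auto dest: is_matching_card_le)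

lemma card_le_opt: "is_matching I M \<Longrightarrow> card M \<le> opt I"
  unfolding opt_def by (rule Max_ge[OF finite_matching_cards]) auto

lemma opt_attained: obtains M where "is_matching I M" "card M = opt I"
proof -
  have "is_matching I {}" by (simp add: is_matching_def)
  then have "opt I \<in> {card M | M. is_matching I M}"
    unfolding opt_def by (intro Max_in[OF finite_matching_cards]) auto
  then show ?thesis using that by auto
qed

text \<open>Functional view of a matching, with \<open>p\<close> sending a matched online index to
  its partner: renaming or replacing partners is easier for a function than for a set of
  pairs.\<close>

lemma is_matching_funD:
  assumes "is_matching I M"
  obtains p where "inj_on p (fst ` M)" "\<And>i. i \<in> fst ` M \<Longrightarrow> i < length I \<and> p i \<in> I ! i"
proof
  let ?p = "\<lambda>i. SOME u. (i, u) \<in> M"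
  have p: "(i, ?p i) \<in> M" if "i \<in> fst ` M" for i
    using that by (force intro: someI)
  then show "i < length I \<and> ?p i \<in> I ! i" if "i \<in> fst ` M" for i
    using assms that unfolding is_matching_def by blast
  show "inj_on ?p (fst ` M)"
  proof (rule inj_onI)
    fix i j assume ij: "i \<in> fst ` M" "j \<in> fst ` M" "?p i = ?p j"
    have "inj_on snd M" using assms by (simp add: is_matching_def)
    from inj_onD[OF this _ p[OF ij(1)] p[OF ij(2)]] ij(3) show "i = j" by simp
  qed
qed

lemma card_le_opt_fun:
  assumes "inj_on p D" "\<And>i. i \<in> D \<Longrightarrow> i < length I \<and> p i \<in> I ! i"
  shows "card D \<le> opt I"
proof -
  let ?M = "(\<lambda>i. (i, p i)) ` D"
  have "is_matching I ?M"
    using assms by (auto simp: is_matching_def inj_on_def)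
  moreover have "card ?M = card D"
    by (subst card_image) (auto simp: inj_on_def)
  ultimately show ?thesis using card_le_opt by metis
qed

lemma length_le_opt:
  assumes "list_all2 (\<in>) zs I" "distinct zs"
  shows "length zs \<le> opt I"
  using card_le_opt_fun[of "\<lambda>i. zs ! i" "{..<length zs}" I] assms
  by (auto simp: list_all2_conv_all_nth inj_on_def nth_eq_iff_index_eq)

lemma approx_ratio_le:
  assumes "valid_instance U I" "opt I > 0" "real (max_value algs U I) \<le> c * real (opt I)"
  shows "approx_ratio algs \<le> c"
proof -
  have "approx_ratio algs \<le> real (max_value algs U I) / real (opt I)"
    unfolding approx_ratio_def
    by (rule cInf_lower) (use assms in \<open>auto intro!: bdd_belowI[of _ 0]\<close>)
  also have "\<dots> \<le> c" using assms by (simp add: field_simps)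
  finally show ?thesis .
qed

lemma approx_ratio_ge:
  assumes "\<And>U I. valid_instance U I \<Longrightarrow> opt I > 0 \<Longrightarrow> c * real (opt I) \<le> real (max_value algs U I)"
  shows "c \<le> approx_ratio algs"
  unfolding approx_ratio_def
proof (rule cInf_greatest)
  \<comment> \<open>\<open>Inf\<close> on the reals is a greatest lower bound only for nonempty
    sets; a single edge supplies an element.\<close>
  have "length [0::nat] \<le> opt [{0}]" by (rule length_le_opt) auto
  moreover have "valid_instance {0} [{0}]" by (simp add: valid_instance_def)
  ultimately show "{real (max_value algs U I) / real (opt I) | U I. valid_instance U I \<and> opt I > 0} \<noteq> {}"
    by fastforce
qed (use assms in \<open>auto simp: field_simps\<close>)

subsection \<open>Hardness\<close>

text \<open>\<open>run_aux\<close> returns only a count. Tracking the matched set allows a run to be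
  resumed after a prefix, as in \<open>run_aux_append\<close>.\<close>

definition matched_step :: "online_alg \<Rightarrow> nat set \<Rightarrow> nat set list \<Rightarrow> nat set \<Rightarrow> nat set \<Rightarrow> nat set" where
  "matched_step A U past N M =
     (case A U past N of Some u \<Rightarrow> if u \<in> N \<and> u \<notin> M then insert u M else M | None \<Rightarrow> M)"

fun matched_after :: "online_alg \<Rightarrow> nat set \<Rightarrow> nat set list \<Rightarrow> nat set list \<Rightarrow> nat set \<Rightarrow> nat set" where
  "matched_after A U past [] M = M"
| "matched_after A U past (N # I) M = matched_after A U (past @ [N]) I (matched_step A U past N M)"

lemma matched_step_cases:
  obtains "matched_step A U past N M = M"
    "\<And>I. run_aux A U past (N # I) M = run_aux A U (past @ [N]) I M"
  | u where "u \<in> N" "u \<notin> M" "matched_step A U past N M = insert u M"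
    "\<And>I. run_aux A U past (N # I) M = Suc (run_aux A U (past @ [N]) I (insert u M))"
proof (cases "\<exists>u. A U past N = Some u \<and> u \<in> N \<and> u \<notin> M")
  case True
  then show ?thesis using that(2) by (auto simp: matched_step_def)
next
  case False
  then show ?thesis
    using that(1) by (cases "A U past N") (auto simp: matched_step_def)
qed

lemma run_aux_append:
  "run_aux A U past (I @ J) M =
     run_aux A U past I M + run_aux A U (past @ I) J (matched_after A U past I M)"
proof (induction I arbitrary: past M)
  case (Cons N I)
  show ?case
    by (cases A U past N M rule: matched_step_cases) (simp_all add: Cons del: run_aux.simps)
qed simp

lemma matched_after_subset: "matched_after A U past I M \<subseteq> M \<union> \<Union>(set I)"
proof (induction I arbitrary: past M)
  case (Cons N I)
  have "matched_step A U past N M \<subseteq> M \<union> N"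
    by (auto simp: matched_step_def split: option.splits)
  with Cons[of "past @ [N]" "matched_step A U past N M"] show ?case by auto
qed simp

lemma run_aux_le_length: "run_aux A U past I M \<le> length I"
proof (induction I arbitrary: past M)
  case (Cons N I)
  show ?case
    using Cons by (cases A U past N M rule: matched_step_cases) (simp_all del: run_aux.simps add: le_SucI)
qed simp

section \<open>Average gain on a random block\<close>

text \<open>For a uniformly random order this is the block with random deletions: each arrival sees
  the vertices not yet deleted. Matching every arrival to the vertex deleted right after it is a
  perfect matching.\<close>

fun suffix_sets :: "nat list \<Rightarrow> nat set list" where
  "suffix_sets [] = []"
| "suffix_sets (x # xs) = set (x # xs) # suffix_sets xs"

lemma length_suffix_sets [simp]: "length (suffix_sets xs) = length xs"
  by (induction xs) auto

lemma Union_suffix_sets [simp]: "\<Union>(set (suffix_sets xs)) = set xs"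
  by (induction xs) auto

lemma list_all2_mem_suffix_sets: "list_all2 (\<in>) xs (suffix_sets xs)"
  by (induction xs) auto

text \<open>Conditions a random order on its first element.\<close>

lemma sum_permutations_of_set:
  assumes "finite S" "S \<noteq> {}"
  shows "(\<Sum>xs\<in>permutations_of_set S. f xs) =
    (\<Sum>x\<in>S. \<Sum>xs\<in>permutations_of_set (S - {x}). f (x # xs))"
proof -
  have "(\<Sum>xs\<in>permutations_of_set S. f xs) =
      (\<Sum>x\<in>S. \<Sum>xs\<in>(#) x ` permutations_of_set (S - {x}). f xs)"
    unfolding permutations_of_set_nonempty[OF assms(2)]
    using assms(1) by (subst sum.UNION_disjoint) auto
  also have "\<dots> = (\<Sum>x\<in>S. \<Sum>xs\<in>permutations_of_set (S - {x}). f (x # xs))"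
    by (rule sum.cong[OF refl]) (rule sum.reindex[unfolded o_def], simp)
  finally show ?thesis .
qed

text \<open>Double counting: a vertex of \<open>S - M\<close> survives the deletion of every
  \<open>x\<close> in \<open>S\<close> but itself.\<close>

lemma sum_card_Diff_singleton:
  assumes "finite S"
  shows "(\<Sum>x\<in>S. card (S - {x} - M)) = card (S - M) * (card S - 1)"
proof -
  let ?R = "S - M"
  have fin: "finite ?R" using assms by auto
  have "(\<Sum>x\<in>S. card (S - {x} - M)) = (\<Sum>x\<in>S. card {y\<in>?R. y \<noteq> x})"
    by (intro sum.cong refl arg_cong[where f=card]) auto
  also have "\<dots> = (\<Sum>x\<in>S. \<Sum>y\<in>?R. if y \<noteq> x then 1 else 0)"
    using fin by (simp flip: sum.inter_filter)
  also have "\<dots> = (\<Sum>y\<in>?R. \<Sum>x\<in>S. if y \<noteq> x then 1 else 0)"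
    by (rule sum.swap)
  also have "\<dots> = (\<Sum>y\<in>?R. card (S - {y}))"
    using assms by (intro sum.cong refl) (auto simp: set_diff_eq eq_commute simp flip: sum.inter_filter)
  also have "\<dots> = (\<Sum>y\<in>?R. card S - 1)"
    using assms by (intro sum.cong refl) auto
  finally show ?thesis by simp
qed

text \<open>With \<open>s\<close> vertices remaining in the neighbourhood, \<open>r\<close> of them free, \<open>\<theta> r / s\<close> decreases on
  average by exactly \<open>\<theta> / s\<close> when a vertex is matched and is constant otherwise; \<open>block_bound\<close>
  adds up the parts of the unit gains that this potential does not pay for.\<close>

definition block_bound :: "real \<Rightarrow> nat \<Rightarrow> real" where
  "block_bound \<theta> s = (\<Sum>i=1..s. max 0 (1 - \<theta> / real i))"

text \<open>Induction on the size of the neighbourhood, with \<open>past\<close> and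
  \<open>M\<close> arbitrary because the first arrival changes both. That arrival sees
  \<open>S\<close> in every order, so the decision does not depend on which vertex is deleted
  next.\<close>

lemma sum_run_aux_suffix_sets_le:
  fixes \<theta> :: real
  assumes "finite S" "\<theta> \<ge> 0"
  shows "(\<Sum>xs\<in>permutations_of_set S. real (run_aux A U past (suffix_sets xs) M)) \<le>
    fact (card S) * (\<theta> * card (S - M) / card S + block_bound \<theta> (card S))"
  using assms(1)
proof (induction "card S" arbitrary: S past M)
  case 0
  then show ?case by (simp add: block_bound_def)
next
  case (Suc s)
  then have "S \<noteq> {}" by auto
  note fin = \<open>finite S\<close> and cS = \<open>Suc s = card S\<close>[symmetric]
  define M' where "M' = matched_step A U past S M"
  define d where "d = card (S - M) - card (S - M')"
  have *: "card (S - M) = card (S - M') + d \<and> d \<le> 1 \<and>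
    (\<forall>I. run_aux A U past (S # I) M = d + run_aux A U (past @ [S]) I M')"
  proof (cases A U past S M rule: matched_step_cases)
    case 1
    then show ?thesis by (simp add: d_def M'_def)
  next
    case (2 u)
    have "S - insert u M = (S - M) - {u}" by auto
    moreover have "card (S - M) > 0" using 2(1,2) fin by (auto simp: card_gt_0_iff)
    ultimately show ?thesis using 2 fin by (simp add: d_def M'_def)
  qed
  have IH: "(\<Sum>xs\<in>permutations_of_set (S - {x}). real (run_aux A U (past @ [S]) (suffix_sets xs) M')) \<le>
      fact s * (\<theta> * card (S - {x} - M') / s + block_bound \<theta> s)" if "x \<in> S" for x
  proof -
    have "s = card (S - {x})" using that cS fin by simp
    from Suc(1)[OF this, of "past @ [S]" M'] fin this show ?thesis by simp
  qed
  have "(\<Sum>xs\<in>permutations_of_set S. real (run_aux A U past (suffix_sets xs) M)) =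
     (\<Sum>x\<in>S. \<Sum>xs\<in>permutations_of_set (S - {x}). real (run_aux A U past (S # suffix_sets xs) M))"
    unfolding sum_permutations_of_set[OF fin \<open>S \<noteq> {}\<close>]
    by (intro sum.cong refl) (auto dest: permutations_of_setD simp: insert_absorb simp del: run_aux.simps)
  also have "\<dots> = (\<Sum>x\<in>S. fact s * real d +
       (\<Sum>xs\<in>permutations_of_set (S - {x}). real (run_aux A U (past @ [S]) (suffix_sets xs) M')))"
    using * fin cS by (intro sum.cong refl) (simp add: sum.distrib)
  also have "\<dots> \<le> (\<Sum>x\<in>S. fact s * real d + fact s * (\<theta> * card (S - {x} - M') / s + block_bound \<theta> s))"
    using IH by (intro sum_mono add_left_mono) auto
  also have "\<dots> = fact (Suc s) * real d + fact (Suc s) * block_bound \<theta> s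
      + fact s * (\<theta> * real (\<Sum>x\<in>S. card (S - {x} - M')) / s)"
    using cS by (simp add: sum.distrib algebra_simps sum_distrib_left sum_divide_distrib)
  \<comment> \<open>For \<open>s > 0\<close> the double count cancels the division by
    \<open>s\<close>; for \<open>s = 0\<close> the last summand on the left is 0, since division by
    zero yields 0.\<close>
  also have "\<dots> \<le> fact (Suc s) * real d + fact (Suc s) * block_bound \<theta> s
      + fact s * (\<theta> * real (card (S - M')))"
    using cS assms(2) by (cases "s = 0") (auto simp: sum_card_Diff_singleton[OF fin])
  also have "\<dots> = fact (Suc s) * (real d + block_bound \<theta> s + \<theta> * real (card (S - M')) / Suc s)"
    by (simp add: field_simps)
  also have "\<dots> \<le> fact (Suc s) * (\<theta> * card (S - M) / Suc s + block_bound \<theta> (Suc s))"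
  proof (rule mult_left_mono)
    \<comment> \<open>A unit gain is paid by the drop \<open>\<theta> / Suc s\<close> of the
      potential and, if that is below 1, by the new summand of \<open>block_bound\<close>.\<close>
    have "real d \<le> \<theta> * real d / Suc s + max 0 (1 - \<theta> / Suc s)"
      using * by (cases "d = 0") (auto simp: le_Suc_eq)
    then show "real d + block_bound \<theta> s + \<theta> * real (card (S - M')) / Suc s
        \<le> \<theta> * card (S - M) / Suc s + block_bound \<theta> (Suc s)"
      using * by (simp add: block_bound_def distrib_left add_divide_distrib)
  qed simp
  finally show ?case by (simp only: cS)
qed

section \<open>Choice of the block size\<close>

text \<open>The left side telescopes into the logarithms of \<open>1 + 1/i\<close> for
  \<open>k < i \<le> B\<close>, each at most \<open>1/i\<close>.\<close>

lemma ln_le_sum_inverse: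
  assumes "k \<le> B"
  shows "ln (real (Suc B) / real (Suc k)) \<le> (\<Sum>i=Suc k..B. 1 / real i)"
  using assms
proof (induction B rule: dec_induct)
  case (step B)
  have "ln (real (Suc (Suc B)) / real (Suc k)) =
     ln (real (Suc B) / real (Suc k)) + ln (1 + 1 / real (Suc B))"
  proof -
    have "real (Suc (Suc B)) / real (Suc k) =
        (real (Suc B) / real (Suc k)) * (1 + 1 / real (Suc B))"
      by (simp add: divide_simps)
    then show ?thesis by (simp only:) (rule ln_mult_pos, auto simp: add_pos_pos)
  qed
  also have "ln (1 + 1 / real (Suc B)) \<le> 1 / real (Suc B)"
    by (rule ln_add_one_self_le_self) simp
  finally show ?case using step by simp
qed simp

text \<open>The summands with \<open>i \<le> k\<close> vanish and the others are
  \<open>1 - k/i\<close>, leaving a tail of the harmonic sum. The extra \<open>k\<close> on the left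
  is the initial potential of a block whose vertices are all free.\<close>

lemma block_bound_le:
  assumes "k \<le> B"
  shows "real k + block_bound (real k) B \<le> real B - real k * ln (real (Suc B) / real (Suc k))"
proof -
  have "block_bound (real k) B = (\<Sum>i=Suc k..B. max 0 (1 - real k / real i))"
    unfolding block_bound_def
    by (rule sum.mono_neutral_right) (auto simp: max_def field_simps)
  also have "\<dots> = (\<Sum>i=Suc k..B. 1 - real k * (1 / real i))"
    by (intro sum.cong refl) (auto simp: max_def field_simps)
  also have "\<dots> = real (B - k) - real k * (\<Sum>i=Suc k..B. 1 / real i)"
    unfolding sum_subtractf sum_distrib_left by simp
  also have "real k * (\<Sum>i=Suc k..B. 1 / real i) \<ge> real k * ln (real (Suc B) / real (Suc k))"
    by (intro mult_left_mono ln_le_sum_inverse assms) simp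
  ultimately show ?thesis using assms by linarith
qed

text \<open>\<open>k * ln (B / k)\<close> is largest at \<open>k = B / e\<close>, where it equals
  \<open>B / e\<close>; hence \<open>k\<close> is the integer part of \<open>B / e\<close>.\<close>

lemma exists_block_size:
  assumes "\<epsilon> > 0"
  obtains B k :: nat where "B > 0"
    "real k + block_bound (real k) B \<le> (1 - exp (-1) + \<epsilon>) * real B"
proof -
  define kf where "kf = (\<lambda>B::nat. nat \<lfloor>real B * exp (-1)\<rfloor>)"
  \<comment> \<open>The floor is avoided by using \<open>k \<ge> B/e - 1\<close> for the factor and
    \<open>k \<le> B/e\<close> inside the logarithm; the loss is of lower order.\<close>
  have "((\<lambda>B. (real B - (real B * exp (-1) - 1) * ln ((real B + 1) / (real B * exp (-1) + 1))) / real B)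
      \<longlongrightarrow> 1 - exp (-1)) sequentially"
    by real_asymp (simp add: exp_minus)
  from order_tendstoD(2)[OF this, of "1 - exp (-1) + \<epsilon>"] assms
  have "eventually (\<lambda>B. (real B - (real B * exp (-1) - 1) * ln ((real B + 1) / (real B * exp (-1) + 1))) / real B
      < 1 - exp (-1) + \<epsilon>) sequentially" by simp
  with eventually_gt_at_top[of 0] have "eventually (\<lambda>B. 0 < B \<and>
      (real B - (real B * exp (-1) - 1) * ln ((real B + 1) / (real B * exp (-1) + 1))) / real B
      < 1 - exp (-1) + \<epsilon>) sequentially" by eventually_elim simp
  then obtain B :: nat where B: "0 < B"
    and lim: "(real B - (real B * exp (-1) - 1) * ln ((real B + 1) / (real B * exp (-1) + 1))) / real B
      < 1 - exp (-1) + \<epsilon>"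
    by (auto dest: eventually_happens)
  have le1: "real B * exp (-1) \<le> real B" by (simp add: mult_left_le)
  have k: "real B * exp (-1) - 1 \<le> real (kf B)" "real (kf B) \<le> real B * exp (-1)"
    unfolding kf_def by (linarith, simp add: of_nat_floor)
  have kB: "kf B \<le> B" using k(2) le1 by linarith
  have ln0: "0 \<le> ln ((real B + 1) / (real B * exp (-1) + 1))"
    using le1 by (intro ln_ge_zero) (simp add: field_simps add_pos_nonneg)
  have "(real B * exp (-1) - 1) * ln ((real B + 1) / (real B * exp (-1) + 1))
      \<le> real (kf B) * ln ((real B + 1) / (real B * exp (-1) + 1))"
    by (rule mult_right_mono[OF k(1) ln0])
  also have "\<dots> \<le> real (kf B) * ln (real (Suc B) / real (Suc (kf B)))"
    using k(2) by (intro mult_left_mono ln_mono divide_pos_pos frac_le) (auto intro: add_nonneg_pos)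
  also have "\<dots> \<le> real B - (real (kf B) + block_bound (real (kf B)) B)"
    using block_bound_le[OF kB] by linarith
  finally have "real (kf B) + block_bound (real (kf B)) B \<le>
      real B - (real B * exp (-1) - 1) * ln ((real B + 1) / (real B * exp (-1) + 1))" by linarith
  also have "\<dots> \<le> (1 - exp (-1) + \<epsilon>) * real B"
    using lim B by (simp add: field_simps)
  finally show ?thesis using that B by blast
qed

section \<open>Exponential moments and concatenation of blocks\<close>

text \<open>For \<open>0 \<le> x \<le> 1\<close>, \<open>exp x \<le> 1 + x + x^2\<close> turns the
  bound on the mean into one on the exponential moment. \<open>M\<close> avoids \<open>S\<close>, so
  the initial potential is \<open>k\<close>.\<close>

lemma sum_exp_run_aux_suffix_sets_le:
  fixes l c :: real
  assumes S: "finite S" "card S = B" "S \<inter> M = {}" and "B > 0"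
    and bound: "real k + block_bound (real k) B \<le> c * real B"
    and l: "0 \<le> l" "l * real B \<le> 1"
  shows "(\<Sum>xs\<in>permutations_of_set S. exp (l * real (run_aux A U past (suffix_sets xs) M)))
    \<le> fact B * exp (l * c * real B + (l * real B)\<^sup>2)"
proof -
  let ?X = "\<lambda>xs. real (run_aux A U past (suffix_sets xs) M)"
  have "exp (l * ?X xs) \<le> (1 + (l * real B)\<^sup>2) + l * ?X xs" if "xs \<in> permutations_of_set S" for xs
  proof -
    have "length xs = B"
      using that S by (metis distinct_card permutations_of_setD)
    then have "?X xs \<le> real B" using run_aux_le_length[of A U past "suffix_sets xs" M] by simp
    then have le: "l * ?X xs \<le> l * real B" using l by (simp add: mult_left_mono)
    have "exp (l * ?X xs) \<le> 1 + l * ?X xs + (l * ?X xs)\<^sup>2"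
      using l le by (intro exp_bound) auto
    also have "(l * ?X xs)\<^sup>2 \<le> (l * real B)\<^sup>2"
      using l le by (intro power_mono) auto
    finally show ?thesis by simp
  qed
  then have "(\<Sum>xs\<in>permutations_of_set S. exp (l * ?X xs)) \<le>
      (\<Sum>xs\<in>permutations_of_set S. (1 + (l * real B)\<^sup>2) + l * ?X xs)"
    by (rule sum_mono)
  also have "\<dots> = fact B * (1 + (l * real B)\<^sup>2) + l * (\<Sum>xs\<in>permutations_of_set S. ?X xs)"
    using S by (simp add: sum.distrib sum_distrib_left)
  also have "\<dots> \<le> fact B * (1 + (l * real B)\<^sup>2) + l * (fact B * (c * real B))"
  proof (intro add_left_mono mult_left_mono l)
    have "(\<Sum>xs\<in>permutations_of_set S. ?X xs) \<le> fact B * (real k + block_bound (real k) B)"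
    using sum_run_aux_suffix_sets_le[OF S(1), of "real k" A U past M] S \<open>B > 0\<close>
      by (simp add: Diff_triv)
    also have "\<dots> \<le> fact B * (c * real B)"
      using bound by (intro mult_left_mono) auto
    finally show "(\<Sum>xs\<in>permutations_of_set S. ?X xs) \<le> fact B * (c * real B)" .
  qed
  also have "\<dots> = fact B * (1 + (l * c * real B + (l * real B)\<^sup>2))"
    by (simp add: algebra_simps)
  also have "\<dots> \<le> fact B * exp (l * c * real B + (l * real B)\<^sup>2)"
    by (intro mult_left_mono exp_ge_add_one_self) auto
  finally show ?thesis .
qed

text \<open>Averaging over all orders of \<open>S\<close>: the exponential of each algorithm factors
  into its value so far and the contribution of the new block. Since the weights of all algorithms
  are added up, one order serves them all.\<close>

lemma exists_block:
  fixes l c :: real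
  assumes S: "finite S" "card S = B" "S \<inter> \<Union>(set I) = {}" and "B > 0"
    and bound: "real k + block_bound (real k) B \<le> c * real B"
    and l: "0 \<le> l" "l * real B \<le> 1"
  shows "\<exists>xs\<in>permutations_of_set S.
    (\<Sum>j<length As. exp (l * real (alg_value (As ! j) U (I @ suffix_sets xs)))) \<le>
    exp (l * c * real B + (l * real B)\<^sup>2) * (\<Sum>j<length As. exp (l * real (alg_value (As ! j) U I)))"
    (is "\<exists>xs\<in>_. ?\<Phi> xs \<le> ?\<rho> * ?\<Psi>")
proof (rule ccontr)
  assume "\<not> ?thesis"
  then have "\<And>xs. xs \<in> permutations_of_set S \<Longrightarrow> ?\<rho> * ?\<Psi> < ?\<Phi> xs" by force
  then have "(\<Sum>xs\<in>permutations_of_set S. ?\<rho> * ?\<Psi>) < (\<Sum>xs\<in>permutations_of_set S. ?\<Phi> xs)"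
    using S by (intro sum_strict_mono) auto
  also have "\<dots> = (\<Sum>j<length As. exp (l * real (alg_value (As ! j) U I)) *
     (\<Sum>xs\<in>permutations_of_set S.
        exp (l * real (run_aux (As ! j) U I (suffix_sets xs) (matched_after (As ! j) U [] I {})))))"
    unfolding alg_value_def run_aux_append
    by (subst sum.swap) (simp add: sum_distrib_left exp_add distrib_left)
  \<comment> \<open>Vertices matched so far occur in \<open>I\<close>, so \<open>S\<close> is
    entirely free for every algorithm.\<close>
  also have "\<dots> \<le> (\<Sum>j<length As. exp (l * real (alg_value (As ! j) U I)) * (fact B * ?\<rho>))"
    using S(3) matched_after_subset[of _ U "[]" I "{}"]
    by (intro sum_mono mult_left_mono sum_exp_run_aux_suffix_sets_le[OF S(1,2) _ \<open>B > 0\<close> bound l]) fastforce+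
  also have "\<dots> = fact B * (?\<rho> * ?\<Psi>)"
    by (simp add: sum_distrib_left sum_distrib_right mult_ac)
  finally show False using S by simp
qed

text \<open>Each block uses a fresh interval of \<open>B\<close> names, and \<open>zs\<close> lists
  the partners of a perfect matching. \<open>U\<close> stays fixed during the induction, since the
  algorithms know the final offline set from the start.\<close>

lemma exists_hard_instance:
  fixes l c :: real
  assumes "B > 0"
    and bound: "real k + block_bound (real k) B \<le> c * real B"
    and l: "0 \<le> l" "l * real B \<le> 1"
  shows "\<exists>zs I. distinct zs \<and> set zs = {..<m * B} \<and> \<Union>(set I) = {..<m * B} \<and> list_all2 (\<in>) zs I \<and>
    (\<Sum>j<length As. exp (l * real (alg_value (As ! j) U I)))
      \<le> real (length As) * exp (l * c * real B + (l * real B)\<^sup>2) ^ m"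
proof (induction m)
  case 0
  show ?case by (intro exI[of _ "[]"]) (simp add: alg_value_def)
next
  case (Suc m)
  then obtain zs I where IH: "distinct zs" "set zs = {..<m * B}" "\<Union>(set I) = {..<m * B}"
    "list_all2 (\<in>) zs I"
    "(\<Sum>j<length As. exp (l * real (alg_value (As ! j) U I)))
      \<le> real (length As) * exp (l * c * real B + (l * real B)\<^sup>2) ^ m" by blast
  let ?S = "{m * B..<Suc m * B}"
  obtain xs where xs: "xs \<in> permutations_of_set ?S"
    "(\<Sum>j<length As. exp (l * real (alg_value (As ! j) U (I @ suffix_sets xs)))) \<le>
      exp (l * c * real B + (l * real B)\<^sup>2) * (\<Sum>j<length As. exp (l * real (alg_value (As ! j) U I)))"
    using exists_block[OF _ _ _ \<open>B > 0\<close> bound l, of ?S I As U, unfolded IH(3)] by fastforce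
  have set_xs: "set xs = ?S" "distinct xs" using xs(1) by (auto dest: permutations_of_setD)
  have un: "{..<m * B} \<union> ?S = {..<Suc m * B}" by auto
  note xs(2)
  also have "exp (l * c * real B + (l * real B)\<^sup>2) * (\<Sum>j<length As. exp (l * real (alg_value (As ! j) U I)))
     \<le> exp (l * c * real B + (l * real B)\<^sup>2) * (real (length As) * exp (l * c * real B + (l * real B)\<^sup>2) ^ m)"
    using IH(5) by (intro mult_left_mono) auto
  finally have "(\<Sum>j<length As. exp (l * real (alg_value (As ! j) U (I @ suffix_sets xs))))
     \<le> real (length As) * exp (l * c * real B + (l * real B)\<^sup>2) ^ Suc m" by (simp add: mult_ac)
  moreover have "distinct (zs @ xs)" "set (zs @ xs) = {..<Suc m * B}"
    "\<Union>(set (I @ suffix_sets xs)) = {..<Suc m * B}" "list_all2 (\<in>) (zs @ xs) (I @ suffix_sets xs)"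
    using IH set_xs un by (auto simp del: mult_Suc intro: list_all2_appendI list_all2_mem_suffix_sets)
  ultimately show ?case by blast
qed

lemma approx_ratio_le_of_subexponential:
  fixes \<epsilon> :: real
  assumes "\<epsilon> > 0" and f: "f \<in> o(\<lambda>n. real n)"
    and len: "\<And>n. real (length (algs n)) \<le> 2 powr f n"
  shows "approx_ratio algs \<le> 1 - exp (-1) + \<epsilon>"
proof -
  \<comment> \<open>Three losses of \<open>\<eta>\<close> occur: block size, quadratic term and
    number of algorithms. The cap at 1 gives \<open>l * real B \<le> 1\<close>.\<close>
  define \<eta> where "\<eta> = min 1 (\<epsilon> / 3)"
  have \<eta>: "0 < \<eta>" "\<eta> \<le> 1" "\<eta> \<le> \<epsilon> / 3" using assms by (auto simp: \<eta>_def)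
  obtain B k where B: "B > 0"
    and bound: "real k + block_bound (real k) B \<le> (1 - exp (-1) + \<eta>) * real B"
    using exists_block_size[OF \<eta>(1)] by blast
  define c where "c = 1 - exp (-1) + \<eta>"
  \<comment> \<open>The quadratic term then equals \<open>\<eta> * (l * real B)\<close>, a loss of
    \<open>\<eta>\<close> per vertex.\<close>
  define l where "l = \<eta> / real B"
  have l: "0 < l" "l * real B = \<eta>" using \<eta> B by (auto simp: l_def)
  have "eventually (\<lambda>n. norm (f n) \<le> l * \<eta> * norm (real n)) at_top"
    by (rule landau_o.smallD[OF f]) (use l \<eta> in simp)
  then obtain n0 where n0: "\<And>n. n \<ge> n0 \<Longrightarrow> \<bar>f n\<bar> \<le> l * \<eta> * real n"
    by (auto simp: eventually_at_top_linorder)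
  define m where "m = Suc n0"
  define n where "n = m * B"
  have n: "n \<ge> n0" "n > 0" using B by (auto simp: n_def m_def trans_le_add2)
  define As where "As = algs n"
  obtain zs I where I: "distinct zs" "set zs = {..<n}" "\<Union>(set I) = {..<n}" "list_all2 (\<in>) zs I"
    and sum_le: "(\<Sum>j<length As. exp (l * real (alg_value (As ! j) {..<n} I)))
      \<le> real (length As) * exp (l * c * real B + (l * real B)\<^sup>2) ^ m"
  proof -
    have "\<exists>zs I. distinct zs \<and> set zs = {..<n} \<and> \<Union>(set I) = {..<n} \<and> list_all2 (\<in>) zs I \<and>
      (\<Sum>j<length As. exp (l * real (alg_value (As ! j) {..<n} I)))
        \<le> real (length As) * exp (l * c * real B + (l * real B)\<^sup>2) ^ m"
      unfolding n_def c_def by (rule exists_hard_instance[OF B bound]) (use l \<eta> in simp_all)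
    with that show thesis by blast
  qed
  have "length zs = n" using I(1,2) distinct_card by force
  with I have len_I: "length I = n" by (auto dest: list_all2_lengthD)
  have opt_I: "n \<le> opt I" using length_le_opt[OF I(4,1)] \<open>length zs = n\<close> by simp
  have alg: "real (alg_value A {..<n} I) \<le> (1 - exp (-1) + \<epsilon>) * real n" if A: "A \<in> set As" for A
  proof -
    obtain j where j: "j < length As" "A = As ! j" using A unfolding in_set_conv_nth by auto
    \<comment> \<open>One summand is at most the whole sum; taking logarithms at the end bounds the
      value.\<close>
    have "exp (l * real (alg_value A {..<n} I)) \<le> (\<Sum>j<length As. exp (l * real (alg_value (As ! j) {..<n} I)))"
      unfolding j(2) using j(1) by (intro member_le_sum) auto
    also note sum_le
    also have "real (length As) \<le> 2 powr (f n)" using len by (simp add: As_def)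
    also have "2 powr (f n) \<le> 2 powr (l * \<eta> * real n)"
      using n0[OF n(1)] by (intro powr_mono) auto
    also have "\<dots> = exp (l * \<eta> * real n * ln 2)" by (simp add: powr_def)
    also have "\<dots> \<le> exp (l * \<eta> * real n * 1)"
      using l \<eta> ln_2_less_1 by (subst exp_le_cancel_iff, intro mult_left_mono) auto
    also have "exp (l * \<eta> * real n * 1) * exp (l * c * real B + (l * real B)\<^sup>2) ^ m =
        exp (l * ((c + 2 * \<eta>) * real n))"
    proof -
      have "l * \<eta> * real n * 1 + real m * (l * c * real B + (l * real B)\<^sup>2) = l * ((c + 2 * \<eta>) * real n)"
        using B by (simp add: n_def l_def field_simps power2_eq_square)
      then show ?thesis by (simp flip: exp_of_nat_mult exp_add)
    qed
    finally have "real (alg_value A {..<n} I) \<le> (c + 2 * \<eta>) * real n"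
      using l by (simp add: mult_right_mono)
    also have "\<dots> \<le> (1 - exp (-1) + \<epsilon>) * real n"
      using \<eta> by (intro mult_right_mono) (auto simp: c_def)
    finally show ?thesis .
  qed
  \<comment> \<open>Covers the element 0 inserted under \<open>Max\<close> in
    \<open>max_value\<close>.\<close>
  have "0 \<le> 1 - exp (-1) + \<epsilon>" using assms(1) by (simp add: add_nonneg_nonneg)
  then have "real (max_value algs {..<n} I) \<le> (1 - exp (-1) + \<epsilon>) * real n"
    using Max_in[of "insert 0 (set (map (\<lambda>A. alg_value A {..<n} I) As))"] alg
    unfolding max_value_def len_I As_def[symmetric] by auto
  also have "\<dots> \<le> (1 - exp (-1) + \<epsilon>) * real (opt I)"
    using opt_I \<open>0 \<le> 1 - exp (-1) + \<epsilon>\<close> by (intro mult_left_mono) auto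
  finally show ?thesis
    using opt_I n I(3) by (intro approx_ratio_le[of "{..<n}" I]) (auto simp: valid_instance_def)
qed

subsection \<open>Ranking\<close>

text \<open>Priorities from a finite set can tie; the smallest name decides, which makes the choice
  a function of \<open>y\<close> and \<open>S\<close>.\<close>

definition argmin_first :: "(nat \<Rightarrow> nat) \<Rightarrow> nat set \<Rightarrow> nat" where
  "argmin_first y S = Min {u \<in> S. \<forall>w\<in>S. y u \<le> y w}"

lemma argmin_first:
  assumes "finite S" "S \<noteq> {}"
  shows "argmin_first y S \<in> S" "w \<in> S \<Longrightarrow> y (argmin_first y S) \<le> y w"
proof -
  have "Min (y ` S) \<in> y ` S" using assms by simp
  then obtain u where "u \<in> S" "y u = Min (y ` S)" by force
  then have "\<forall>w\<in>S. y u \<le> y w" using assms by simp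
  with \<open>u \<in> S\<close> have "argmin_first y S \<in> {u \<in> S. \<forall>w\<in>S. y u \<le> y w}"
    unfolding argmin_first_def using assms(1) by (intro Min_in) auto
  then show "argmin_first y S \<in> S" "w \<in> S \<Longrightarrow> y (argmin_first y S) \<le> y w" by auto
qed

text \<open>Consistent tie-breaking: a new candidate can only win itself, not shift the choice among
  the old ones. This keeps runs with and without an extra vertex close.\<close>

lemma argmin_first_insert:
  assumes "finite S" "S \<noteq> {}"
  shows "argmin_first y (insert x S) \<in> {x, argmin_first y S}"
proof (cases "argmin_first y (insert x S) = x")
  case False
  let ?p = "argmin_first y (insert x S)" and ?q = "argmin_first y S"
  have p: "?p \<in> S" "\<And>w. w \<in> insert x S \<Longrightarrow> y ?p \<le> y w"
    using argmin_first[where S="insert x S" and y=y] assms False by auto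
  have q: "?q \<in> S" "\<And>w. w \<in> S \<Longrightarrow> y ?q \<le> y w"
    using argmin_first[OF assms, where y=y] by auto
  have eq: "y ?p = y ?q" using p q by (simp add: order.antisym)
  have "?p \<le> ?q" unfolding argmin_first_def[of y "insert x S"]
    by (rule Min_le) (use assms p q eq in auto)
  moreover have "?q \<le> ?p" unfolding argmin_first_def[of y S]
    by (rule Min_le) (use assms p q eq in auto)
  ultimately show ?thesis by simp
qed simp

lemma argmin_first_cong:
  assumes "\<And>u. u \<in> S \<Longrightarrow> y u = z u"
  shows "argmin_first y S = argmin_first z S"
  using assms unfolding argmin_first_def by (metis (mono_tags, lifting))

text \<open>The argument \<open>R\<close> is the set of still unmatched offline vertices; entry \<open>i\<close> of the
  result is the partner of online vertex \<open>i\<close>.\<close>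

fun ranking :: "(nat \<Rightarrow> nat) \<Rightarrow> nat set list \<Rightarrow> nat set \<Rightarrow> nat option list" where
  "ranking y [] R = []"
| "ranking y (N # I) R =
    (if N \<inter> R = {} then None # ranking y I R
     else Some (argmin_first y (N \<inter> R)) # ranking y I (R - {argmin_first y (N \<inter> R)}))"

lemma length_ranking [simp]: "length (ranking y I R) = length I"
  by (induction y I R rule: ranking.induct) auto

text \<open>Expresses that Ranking is online.\<close>

lemma ranking_take: "ranking y (take k I) R = take k (ranking y I R)"
proof (induction y I R arbitrary: k rule: ranking.induct)
  case (2 y N I R)
  then show ?case by (cases k) auto
qed simp

lemma ranking_cong:
  assumes "\<And>u. u \<in> R \<Longrightarrow> y u = z u"
  shows "ranking y I R = ranking z I R"
  using assms
proof (induction y I R rule: ranking.induct)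
  case (2 y N I R)
  have "argmin_first y (N \<inter> R) = argmin_first z (N \<inter> R)"
    by (rule argmin_first_cong) (use 2 in auto)
  with 2 show ?case by auto
qed simp

lemma set_ranking:
  assumes "finite R" "Some u \<in> set (ranking y I R)"
  shows "u \<in> R"
  using assms
proof (induction y I R rule: ranking.induct)
  case (2 y N I R)
  then show ?case using argmin_first(1)[of "N \<inter> R" y] by (auto split: if_splits)
qed simp

lemma ranking_nth_mem:
  assumes "finite R" "i < length I" "ranking y I R ! i = Some u"
  shows "u \<in> I ! i"
  using assms
proof (induction y I R arbitrary: i rule: ranking.induct)
  case (2 y N I R)
  then show ?case using argmin_first(1)[of "N \<inter> R" y]
    by (cases i) (auto split: if_splits)
qed simp

lemma ranking_nth_inj:
  assumes "finite R" "i < j" "j < length I" "ranking y I R ! i = Some u"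
  shows "ranking y I R ! j \<noteq> Some u"
  using assms
proof (induction y I R arbitrary: i j rule: ranking.induct)
  case (2 y N I R)
  from 2(4,5) obtain j' where j: "j = Suc j'" "j' < length I" by (cases j) auto
  show ?case
  proof (cases i)
    case 0
    then show ?thesis
      using 2(6) j set_ranking[of "R - {u}" u y I] 2(3)
      by (auto split: if_splits simp: in_set_conv_nth)
  next
    case (Suc i')
    then show ?thesis using 2 j by (auto split: if_splits)
  qed
qed simp

text \<open>Adding one more offline vertex changes the set of free vertices, at every point of time,
  by at most one additional vertex.\<close>

lemma ranking_insert_le:
  assumes "finite R" "i < length I" "ranking y I R ! i = Some w"
  shows "\<exists>w'. ranking y I (insert x R) ! i = Some w' \<and> y w' \<le> y w"
  using assms
proof (induction I arbitrary: i R x)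
  case (Cons N I)
  show ?case
  proof (cases "x \<in> N \<and> x \<notin> R")
    case False
    then consider "x \<in> R" | "x \<notin> N" "x \<notin> R" by auto
    then show ?thesis
    proof cases
      case 1
      then show ?thesis using Cons.prems by (simp add: insert_absorb del: ranking.simps)
    next
      case 2
      then have "N \<inter> insert x R = N \<inter> R" by auto
      moreover have "insert x R - {argmin_first y (N \<inter> R)} = insert x (R - {argmin_first y (N \<inter> R)})"
        if "N \<inter> R \<noteq> {}"
        using argmin_first(1)[of "N \<inter> R" y] that Cons.prems(1) 2 by auto
      ultimately show ?thesis
        using Cons.prems Cons.IH[of R "i - 1" x] Cons.IH[of "R - {argmin_first y (N \<inter> R)}" "i - 1" x]
        by (cases i) (auto split: if_splits)
    qed
  next
    case x: True
    let ?p = "argmin_first y (insert x (N \<inter> R))" and ?q = "argmin_first y (N \<inter> R)"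
    have NR: "N \<inter> insert x R = insert x (N \<inter> R)" using x by auto
    have step: "ranking y (N # I) (insert x R) = Some ?p # ranking y I (insert x R - {?p})"
      using NR by simp
    show ?thesis
    proof (cases "N \<inter> R = {}")
      case True
      \<comment> \<open>Only \<open>x\<close> is available, so the larger run takes it and both runs
        have the same free set afterwards.\<close>
      have "?p = x" using argmin_first(1)[of "{x}" y] True by simp
      then have "insert x R - {?p} = R" using x by auto
      then show ?thesis using Cons.prems step True by (cases i) auto
    next
      case False
      have q: "?q \<in> N \<inter> R" using False Cons.prems(1) by (intro argmin_first) auto
      have le: "y ?p \<le> y ?q" using q Cons.prems(1) by (intro argmin_first) auto
      have "?p \<in> {x, ?q}" by (rule argmin_first_insert) (use False Cons.prems(1) in auto)
      \<comment> \<open>\<open>x'\<close> is the surplus free vertex after this step: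
        \<open>?q\<close> if \<open>x\<close> was taken, and \<open>x\<close> otherwise.\<close>
      then obtain x' where x': "insert x R - {?p} = insert x' (R - {?q})"
        using x q by (cases "?p = x") (auto simp: insert_Diff_if insert_absorb)
      show ?thesis
        using Cons.prems False step x' le Cons.IH[of "R - {?q}" "i - 1" x'] by (cases i) auto
    qed
  qed
qed simp

text \<open>While \<open>x\<close> is free, the runs with and without \<open>x\<close> make the same
  choices. If \<open>x\<close> is still free when vertex \<open>i\<close> arrives, it strictly beats
  the partner that \<open>i\<close> would have had, if any, and is taken.\<close>

lemma ranking_insert_matched:
  assumes "finite R" "i < length I" "x \<in> I ! i" "x \<notin> R"
    and "\<And>w. ranking y I R ! i = Some w \<Longrightarrow> y x < y w"
  shows "Some x \<in> set (ranking y I (insert x R))"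
  using assms
proof (induction I arbitrary: i R)
  case (Cons N I)
  let ?p = "argmin_first y (N \<inter> insert x R)" and ?q = "argmin_first y (N \<inter> R)"
  have q: "?q \<in> N \<inter> R" if "N \<inter> R \<noteq> {}" using that Cons.prems(1) by (intro argmin_first) auto
  show ?case
  proof (cases "x \<in> N \<and> ?p = x")
    case True
    then show ?thesis by auto
  next
    case px: False
    have pq: "N \<inter> R \<noteq> {} \<and> ?p = ?q" if "x \<in> N"
    proof -
      have eq: "N \<inter> insert x R = insert x (N \<inter> R)" using that by auto
      have "?p \<in> insert x (N \<inter> R)" unfolding eq using Cons.prems(1) by (intro argmin_first) auto
      then have "N \<inter> R \<noteq> {}" using px that by auto
      then show ?thesis
        using argmin_first_insert[of "N \<inter> R" y x] px that Cons.prems(1) by (simp add: eq)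
    qed
    show ?thesis
    proof (cases i)
      case 0
      then have xN: "x \<in> N" using Cons.prems by simp
      have "y ?p \<le> y x" using xN Cons.prems(1) by (intro argmin_first) auto
      moreover have "y x < y ?q" using Cons.prems(5)[of ?q] 0 pq[OF xN] by simp
      ultimately show ?thesis using pq[OF xN] by simp
    next
      case (Suc i')
      show ?thesis
      proof (cases "N \<inter> R = {}")
        case True
        then have "x \<notin> N" using pq by auto
        then show ?thesis using Cons.prems Suc True Cons.IH[of R i'] by (auto simp: Int_insert_right)
      next
        case False
        have p: "?p = ?q" using pq by (cases "x \<in> N") auto
        have "insert x R - {?q} = insert x (R - {?q})" using q[OF False] Cons.prems(4) by auto
        then show ?thesis
          using Cons.prems Suc False Cons.IH[of "R - {?q}" i'] p by (auto simp: Int_insert_right)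
      qed
    qed
  qed
qed simp

definition rank_value :: "(nat \<Rightarrow> nat) \<Rightarrow> nat set list \<Rightarrow> nat set \<Rightarrow> nat" where
  "rank_value y I R = card {i. i < length I \<and> ranking y I R ! i \<noteq> None}"

lemma inj_on_ranking:
  assumes "finite R"
  shows "inj_on (\<lambda>i. the (ranking y I R ! i)) {i. i < length I \<and> ranking y I R ! i \<noteq> None}"
    (is "inj_on _ ?D")
proof (rule linorder_inj_onI)
  fix i j assume "i < j" "i \<in> ?D" "j \<in> ?D"
  then show "the (ranking y I R ! i) \<noteq> the (ranking y I R ! j)"
    using ranking_nth_inj[OF assms, of i j I y] by auto
qed auto

lemma rank_value_le_opt:
  assumes "finite R"
  shows "rank_value y I R \<le> opt I"
  unfolding rank_value_def
  by (rule card_le_opt_fun[OF inj_on_ranking[OF assms]])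
    (use ranking_nth_mem[OF assms] in auto)

section \<open>Uniformly random priorities\<close>

text \<open>Sample space of independent uniform priorities; \<open>PiE\<close> makes it finite, so
  averages are finite sums.\<close>

definition seeds :: "nat \<Rightarrow> nat \<Rightarrow> (nat \<Rightarrow> nat) set" where
  "seeds K L = PiE {..<K} (\<lambda>_. {..<L})"

lemma finite_seeds [simp]: "finite (seeds K L)"
  by (simp add: seeds_def finite_PiE)

lemma seeds_nonempty: "L > 0 \<Longrightarrow> seeds K L \<noteq> {}"
  by (simp add: seeds_def PiE_eq_empty_iff lessThan_empty_iff)

lemma seeds_less: "y \<in> seeds K L \<Longrightarrow> u < K \<Longrightarrow> y u < L"
  by (auto simp: seeds_def PiE_iff)

lemma seeds_upd: "y \<in> seeds K L \<Longrightarrow> u < K \<Longrightarrow> j < L \<Longrightarrow> y(u := j) \<in> seeds K L"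
  by (auto simp: seeds_def PiE_iff extensional_def)

text \<open>Redrawing the priority of \<open>u\<close> preserves the distribution: exchanging
  \<open>y u\<close> with \<open>j\<close> is an involution on pairs \<open>(y, j)\<close>.\<close>

lemma sum_seeds_resample:
  fixes \<phi> :: "(nat \<Rightarrow> nat) \<Rightarrow> real"
  assumes "u < K"
  shows "(\<Sum>y\<in>seeds K L. \<Sum>j<L. \<phi> (y(u := j))) = real L * (\<Sum>y\<in>seeds K L. \<phi> y)"
proof -
  have "(\<Sum>y\<in>seeds K L. \<Sum>j<L. \<phi> (y(u := j))) = (\<Sum>(y, j)\<in>seeds K L \<times> {..<L}. \<phi> (y(u := j)))"
    by (simp add: sum.cartesian_product)
  also have "\<dots> = (\<Sum>(y, j)\<in>seeds K L \<times> {..<L}. \<phi> y)"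
    by (rule sum.reindex_bij_witness[of _ "\<lambda>(y, j). (y(u := j), y u)" "\<lambda>(y, j). (y(u := j), y u)"])
      (use assms in \<open>auto intro: seeds_upd seeds_less\<close>)
  also have "\<dots> = real L * (\<Sum>y\<in>seeds K L. \<phi> y)"
    by (simp add: sum_distrib_left flip: sum.cartesian_product)
  finally show ?thesis .
qed

section \<open>Primal-dual analysis of Ranking\<close>

text \<open>Discrete version of \<open>exp (x - 1)\<close> at \<open>x = j / L\<close>. Each
  increment is \<open>gain L j / L\<close>, so sums of gains telescope as the exponential integrates
  to itself; the normalisation gives \<open>gain L L = 1\<close>.\<close>

definition gain :: "nat \<Rightarrow> nat \<Rightarrow> real" where
  "gain L j = (1 + 1 / real L) ^ j / (1 + 1 / real L) ^ L"

definition ranking_ratio :: "nat \<Rightarrow> real" where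
  "ranking_ratio L = 1 - gain L 0"

lemma gain_nonneg: "0 \<le> gain L j"
  by (simp add: gain_def)

lemma gain_mono: "i \<le> j \<Longrightarrow> gain L i \<le> gain L j"
  by (auto simp: gain_def intro!: divide_right_mono power_increasing)

lemma gain_top: "gain L L = 1"
  by (simp add: gain_def add_nonneg_eq_0_iff)

lemma gain_le_1: "j \<le> L \<Longrightarrow> gain L j \<le> 1"
  using gain_mono[of j L L] by (simp add: gain_top)

lemma sum_gain:
  assumes "L > 0"
  shows "(\<Sum>j<c. gain L j) = real L * (gain L c - gain L 0)"
proof (induction c)
  case (Suc c)
  have "gain L (Suc c) = gain L c * (1 + 1 / real L)" by (simp add: gain_def)
  then show ?case using Suc assms by (simp add: field_simps)
qed simp

definition offline_share :: "nat \<Rightarrow> (nat \<Rightarrow> nat) \<Rightarrow> nat set list \<Rightarrow> nat set \<Rightarrow> nat \<Rightarrow> real" where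
  "offline_share L y I R u = (if Some u \<in> set (ranking y I R) then gain L (y u) else 0)"

definition online_share :: "nat \<Rightarrow> (nat \<Rightarrow> nat) \<Rightarrow> nat set list \<Rightarrow> nat set \<Rightarrow> nat \<Rightarrow> real" where
  "online_share L y I R i = (case ranking y I R ! i of None \<Rightarrow> 0 | Some w \<Rightarrow> 1 - gain L (y w))"

text \<open>The two shares of a matched edge add up to 1, all shares are nonnegative, and
  \<open>M\<close> meets each vertex at most once.\<close>

lemma sum_shares_le:
  assumes "finite R" "\<And>w. w \<in> R \<Longrightarrow> y w < L" "is_matching I M"
  shows "(\<Sum>(i, u)\<in>M. offline_share L y I R u + online_share L y I R i) \<le> real (rank_value y I R)"
proof -
  let ?out = "ranking y I R"
  let ?D = "{i. i < length I \<and> ?out ! i \<noteq> None}"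
  let ?p = "\<lambda>i. the (?out ! i)"
  have finM: "finite M" using is_matching_card_le[OF assms(3)] by simp
  have M: "inj_on fst M" "inj_on snd M" "fst ` M \<subseteq> {..<length I}"
    using assms(3) by (auto simp: is_matching_def)
  have out: "?out ! i = Some u \<Longrightarrow> i < length I \<Longrightarrow> y u < L" for i u
    using assms(2) set_ranking[OF assms(1)] by (metis length_ranking nth_mem)
  have inj: "inj_on ?p ?D" by (rule inj_on_ranking[OF assms(1)])
  have D: "Some u \<in> set ?out \<longleftrightarrow> u \<in> ?p ` ?D" for u
    by (force simp: in_set_conv_nth image_iff)
  have "(\<Sum>(i, u)\<in>M. offline_share L y I R u) = (\<Sum>u\<in>snd ` M. offline_share L y I R u)"
    using M by (subst sum.reindex) (auto simp: case_prod_beta)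
  also have "\<dots> \<le> (\<Sum>u\<in>snd ` M \<union> ?p ` ?D. offline_share L y I R u)"
    using finM by (intro sum_mono2) (auto simp: offline_share_def gain_nonneg)
  also have "\<dots> = (\<Sum>u\<in>?p ` ?D. gain L (y u))"
    using finM D by (intro sum.mono_neutral_cong_right) (auto simp: offline_share_def)
  also have "\<dots> = (\<Sum>i\<in>?D. gain L (y (?p i)))"
    using inj by (subst sum.reindex) auto
  finally have 1: "(\<Sum>(i, u)\<in>M. offline_share L y I R u) \<le> (\<Sum>i\<in>?D. gain L (y (?p i)))" .
  have nonneg: "i < length I \<Longrightarrow> 0 \<le> online_share L y I R i" for i
    using out gain_le_1[of _ L] by (auto simp: online_share_def split: option.splits intro: less_imp_le)
  have "(\<Sum>(i, u)\<in>M. online_share L y I R i) = (\<Sum>i\<in>fst ` M. online_share L y I R i)"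
    using M by (subst sum.reindex) (auto simp: case_prod_beta)
  also have "\<dots> \<le> (\<Sum>i<length I. online_share L y I R i)"
    using M nonneg by (intro sum_mono2) auto
  also have "\<dots> = (\<Sum>i\<in>?D. 1 - gain L (y (?p i)))"
    by (intro sum.mono_neutral_cong_right) (auto simp: online_share_def)
  finally have 2: "(\<Sum>(i, u)\<in>M. online_share L y I R i) \<le> (\<Sum>i\<in>?D. 1 - gain L (y (?p i)))" .
  have "(\<Sum>(i, u)\<in>M. offline_share L y I R u + online_share L y I R i)
      \<le> (\<Sum>i\<in>?D. gain L (y (?p i)) + (1 - gain L (y (?p i))))"
    using 1 2 unfolding sum.distrib case_prod_beta by linarith
  then show ?thesis by (simp add: rank_value_def)
qed

text \<open>Compare with the run without \<open>u\<close>, which does not depend on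
  \<open>j\<close>. Let \<open>c\<close> be the priority of the partner of \<open>i\<close> there.
  If \<open>j < c\<close>, then \<open>u\<close> gets matched; for every \<open>j\<close>, vertex
  \<open>i\<close> gets a partner at least as good. The bounds
  \<open>L * (gain L c - gain L 0)\<close> and \<open>L * (1 - gain L c)\<close> add up
  independently of \<open>c\<close>.\<close>

lemma sum_edge_shares_ge:
  assumes "finite R" "\<And>w. w \<in> R \<Longrightarrow> y w < L" "u \<in> R" "i < length I" "u \<in> I ! i"
  shows "real L * ranking_ratio L \<le>
    (\<Sum>j<L. offline_share L (y(u := j)) I R u + online_share L (y(u := j)) I R i)"
proof -
  let ?R = "R - {u}"
  have L: "L > 0" using assms(2,3) by fastforce
  have R: "insert u ?R = R" "finite ?R" "u \<notin> ?R" using assms by auto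
  \<comment> \<open>The default \<open>L\<close> fits an unmatched \<open>i\<close>: every
    \<open>j < L\<close> lies below it, and \<open>1 - gain L L = 0\<close> claims nothing for
    \<open>i\<close>.\<close>
  define c where "c = (case ranking y I ?R ! i of None \<Rightarrow> L | Some w \<Rightarrow> y w)"
  have out: "ranking (y(u := j)) I ?R = ranking y I ?R" for j
    by (rule ranking_cong) auto
  have mem: "w \<in> ?R" if "ranking y I ?R ! i = Some w" for w
    using that set_ranking[OF R(2)] assms(4) by (metis length_ranking nth_mem)
  have cL: "c \<le> L"
    using mem assms(2) by (auto simp: c_def split: option.splits intro: less_imp_le)
  have on: "1 - gain L c \<le> online_share L (y(u := j)) I R i" if "j < L" for j
  proof (cases "ranking y I ?R ! i")
    case None
    have "0 \<le> online_share L (y(u := j)) I R i"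
    proof (cases "ranking (y(u := j)) I R ! i")
      case (Some w)
      then have "w \<in> R" using set_ranking[OF assms(1)] assms(4) by (metis length_ranking nth_mem)
      then have "(y(u := j)) w \<le> L" using assms(2) that by (auto intro: less_imp_le)
      then show ?thesis using Some gain_le_1 by (simp add: online_share_def)
    qed (simp add: online_share_def)
    then show ?thesis by (simp add: c_def None gain_top)
  next
    case (Some w)
    then have "w \<noteq> u" using mem by auto
    obtain w' where w': "ranking (y(u := j)) I R ! i = Some w'" "(y(u := j)) w' \<le> (y(u := j)) w"
      using ranking_insert_le[OF R(2) assms(4), of "y(u := j)" w u] Some unfolding out R(1) by auto
    then have "gain L ((y(u := j)) w') \<le> gain L c"
      using \<open>w \<noteq> u\<close> Some by (intro gain_mono) (simp add: c_def)
    then show ?thesis using w'(1) by (simp add: online_share_def)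
  qed
  have off: "(if j < c then gain L j else 0) \<le> offline_share L (y(u := j)) I R u" if "j < L" for j
  proof (cases "j < c")
    case True
    have "Some u \<in> set (ranking (y(u := j)) I (insert u ?R))"
    proof (rule ranking_insert_matched[OF R(2) assms(4,5) R(3)])
      fix w assume w: "ranking (y(u := j)) I ?R ! i = Some w"
      then have "ranking y I ?R ! i = Some w" unfolding out .
      with mem True show "(y(u := j)) u < (y(u := j)) w" by (auto simp: c_def)
    qed
    then show ?thesis using True R(1) by (simp add: offline_share_def)
  qed (simp add: offline_share_def gain_nonneg)
  have "(\<Sum>j<L. if j < c then gain L j else 0) = (\<Sum>j<c. gain L j)"
    using cL by (intro sum.mono_neutral_cong_right) auto
  then have "real L * ranking_ratio L = (\<Sum>j<L. (if j < c then gain L j else 0) + (1 - gain L c))"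
    using sum_gain[OF L, of c] unfolding sum.distrib by (simp add: ranking_ratio_def algebra_simps)
  also have "\<dots> \<le> (\<Sum>j<L. offline_share L (y(u := j)) I R u + online_share L (y(u := j)) I R i)"
    using on off by (intro sum_mono add_mono) auto
  finally show ?thesis .
qed

text \<open>For each edge of an optimal matching, redrawing the priority of its offline endpoint
  makes \<open>sum_edge_shares_ge\<close> applicable; the shares are then summed over the
  matching.\<close>

lemma sum_rank_value_ge:
  assumes "L > 0" "\<And>N. N \<in> set I \<Longrightarrow> N \<subseteq> {..<K}"
  shows "real (card (seeds K L)) * (ranking_ratio L * real (opt I)) \<le>
    (\<Sum>y\<in>seeds K L. real (rank_value y I {..<K}))"
proof -
  obtain M where M: "is_matching I M" "card M = opt I" by (rule opt_attained)
  let ?s = "\<lambda>y (i, u). offline_share L y I {..<K} u + online_share L y I {..<K} i"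
  have "real (card (seeds K L)) * ranking_ratio L \<le> (\<Sum>y\<in>seeds K L. ?s y e)" if e: "e \<in> M" for e
  proof -
    obtain i u where iu: "e = (i, u)" "i < length I" "u \<in> I ! i"
      using M(1) e by (cases e) (auto simp: is_matching_def)
    have "u < K" using iu assms(2) nth_mem by blast
    have "real L * (real (card (seeds K L)) * ranking_ratio L) = (\<Sum>y\<in>seeds K L. real L * ranking_ratio L)"
      by simp
    also have "\<dots> \<le> (\<Sum>y\<in>seeds K L. \<Sum>j<L. ?s (y(u := j)) (i, u))"
      unfolding prod.case using iu \<open>u < K\<close>
      by (intro sum_mono sum_edge_shares_ge) (auto intro: seeds_less)
    also have "\<dots> = real L * (\<Sum>y\<in>seeds K L. ?s y (i, u))"
      by (rule sum_seeds_resample[OF \<open>u < K\<close>])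
    finally show ?thesis using assms(1) iu(1) by simp
  qed
  then have "(\<Sum>e\<in>M. real (card (seeds K L)) * ranking_ratio L) \<le> (\<Sum>e\<in>M. \<Sum>y\<in>seeds K L. ?s y e)"
    by (rule sum_mono)
  also have "\<dots> = (\<Sum>y\<in>seeds K L. \<Sum>e\<in>M. ?s y e)" by (rule sum.swap)
  also have "\<dots> \<le> (\<Sum>y\<in>seeds K L. real (rank_value y I {..<K}))"
    using seeds_less by (intro sum_mono sum_shares_le M) auto
  finally show ?thesis by (simp add: M(2) mult_ac)
qed

section \<open>From the average to a short list of priority functions\<close>

text \<open>Reverse Markov inequality: no value exceeds \<open>opt I\<close>, so an average of
  \<open>ranking_ratio L * opt I\<close> forces a fraction \<open>\<delta>\<close> of values to be
  within \<open>\<delta> * opt I\<close> of it.\<close>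

lemma card_good_seeds_ge:
  assumes "L > 0" "\<And>N. N \<in> set I \<Longrightarrow> N \<subseteq> {..<K}" and \<delta>: "0 \<le> \<delta>" "\<delta> \<le> 1"
  shows "\<delta> * real (card (seeds K L)) \<le>
    real (card {y \<in> seeds K L. (ranking_ratio L - \<delta>) * real (opt I) \<le> real (rank_value y I {..<K})})"
    (is "_ \<le> real (card ?G)")
proof (cases "opt I = 0 \<or> ranking_ratio L \<le> \<delta>")
  case True
  then have "(ranking_ratio L - \<delta>) * real (opt I) \<le> 0"
    by (auto simp: mult_nonpos_nonneg)
  then have "?G = seeds K L" by (auto intro: order_trans)
  then show ?thesis using \<delta> by (simp add: mult_left_le_one_le)
next
  case False
  have "real (card (seeds K L)) * (ranking_ratio L * real (opt I)) \<le>
    (\<Sum>y\<in>seeds K L. real (rank_value y I {..<K}))"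
    by (rule sum_rank_value_ge[OF assms(1,2)])
  also have "\<dots> \<le> (\<Sum>y\<in>seeds K L. (if y \<in> ?G then real (opt I) else 0) +
      (ranking_ratio L - \<delta>) * real (opt I))"
    using False rank_value_le_opt[of "{..<K}" _ I] by (intro sum_mono) (auto intro: add_increasing2)
  also have "\<dots> = real (card ?G) * real (opt I) +
      real (card (seeds K L)) * ((ranking_ratio L - \<delta>) * real (opt I))"
    by (simp add: sum.distrib Collect_conj_eq flip: sum.inter_filter)
  finally have "\<delta> * real (card (seeds K L)) * real (opt I) \<le> real (card ?G) * real (opt I)"
    by (simp add: algebra_simps)
  then show ?thesis using False by simp
qed

text \<open>Greedy choice: by double counting, some \<open>y\<close> is good for a fraction
  \<open>\<delta>\<close> of the elements not yet hit.\<close>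

lemma exists_hitting_list:
  fixes good :: "'a \<Rightarrow> 'b \<Rightarrow> bool"
  assumes "finite X" "finite Y" "Y \<noteq> {}" "\<delta> \<le> 1"
    and good: "\<And>x. x \<in> X \<Longrightarrow> \<delta> * real (card Y) \<le> real (card {y \<in> Y. good x y})"
  shows "\<exists>ys. length ys = k \<and> real (card {x \<in> X. \<forall>y\<in>set ys. \<not> good x y}) \<le> (1 - \<delta>) ^ k * real (card X)"
proof (induction k)
  case 0
  show ?case by simp
next
  case (Suc k)
  then obtain ys where ys: "length ys = k"
    "real (card {x \<in> X. \<forall>y\<in>set ys. \<not> good x y}) \<le> (1 - \<delta>) ^ k * real (card X)" by blast
  let ?X = "{x \<in> X. \<forall>y\<in>set ys. \<not> good x y}"
  have fin: "finite ?X" using assms(1) by simp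
  have "\<exists>y\<in>Y. real (card {x \<in> ?X. \<not> good x y}) \<le> (1 - \<delta>) * real (card ?X)"
  proof (rule ccontr)
    assume "\<not> ?thesis"
    then have "(\<Sum>y\<in>Y. (1 - \<delta>) * real (card ?X)) < (\<Sum>y\<in>Y. real (card {x \<in> ?X. \<not> good x y}))"
      using assms by (intro sum_strict_mono) auto
    also have "\<dots> = (\<Sum>y\<in>Y. \<Sum>x\<in>?X. if \<not> good x y then 1 else 0)"
      using fin by (simp flip: sum.inter_filter)
    also have "\<dots> = (\<Sum>x\<in>?X. \<Sum>y\<in>Y. if \<not> good x y then 1 else 0)"
      by (rule sum.swap)
    also have "\<dots> = (\<Sum>x\<in>?X. real (card {y \<in> Y. \<not> good x y}))"
      using assms(2) by (simp flip: sum.inter_filter)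
    also have "\<dots> \<le> (\<Sum>x\<in>?X. (1 - \<delta>) * real (card Y))"
    proof (rule sum_mono)
      fix x assume "x \<in> ?X"
      then have "\<delta> * real (card Y) \<le> real (card {y \<in> Y. good x y})" using good by simp
      moreover have "card {y \<in> Y. \<not> good x y} = card Y - card {y \<in> Y. good x y}"
        using assms(2) by (subst card_Diff_subset[symmetric]) (auto intro: arg_cong[where f = card])
      moreover have "card {y \<in> Y. good x y} \<le> card Y" using assms(2) by (auto intro: card_mono)
      ultimately show "real (card {y \<in> Y. \<not> good x y}) \<le> (1 - \<delta>) * real (card Y)"
        by (simp add: of_nat_diff algebra_simps)
    qed
    finally show False by (simp add: mult_ac)
  qed
  then obtain y where y: "real (card {x \<in> ?X. \<not> good x y}) \<le> (1 - \<delta>) * real (card ?X)" by blast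
  have "{x \<in> X. \<forall>y'\<in>set (y # ys). \<not> good x y'} = {x \<in> ?X. \<not> good x y}" by auto
  with y have "real (card {x \<in> X. \<forall>y'\<in>set (y # ys). \<not> good x y'}) \<le> (1 - \<delta>) * real (card ?X)" by simp
  also have "\<dots> \<le> (1 - \<delta>) * ((1 - \<delta>) ^ k * real (card X))"
    using ys(2) assms(4) by (intro mult_left_mono) auto
  finally show ?case using ys(1) by (intro exI[of _ "y # ys"]) (simp add: mult_ac)
qed

subsection \<open>Canonical names for offline vertices\<close>

text \<open>Among \<open>n\<close> online vertices, one with \<open>n\<close> neighbours always
  finds a free one, so \<open>n\<close> neighbours suffice for the optimum. An infinite
  \<open>N\<close> is sent to the empty set.\<close>

definition trunc :: "nat \<Rightarrow> nat set \<Rightarrow> nat set" where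
  "trunc n N = set (take n (sorted_list_of_set N))"

lemma finite_trunc [simp]: "finite (trunc n N)"
  by (simp add: trunc_def)

lemma card_trunc: "card (trunc n N) = min n (card N)"
  by (simp add: trunc_def distinct_card)

lemma trunc_subset: "trunc n N \<subseteq> N"
proof (cases "finite N")
  case True
  then show ?thesis using set_take_subset[of n "sorted_list_of_set N"] by (simp add: trunc_def)
qed (simp add: trunc_def)

lemma trunc_eq: "finite N \<Longrightarrow> card N \<le> n \<Longrightarrow> trunc n N = N"
  by (simp add: trunc_def)

text \<open>Values on \<open>B\<close> are chosen one by one; fewer than \<open>n\<close> are in use
  each time, so \<open>T i\<close> offers a new one.\<close>

lemma extend_inj:
  assumes "finite B" "finite A" "A \<inter> B = {}" "inj_on p A"
    and "card (A \<union> B) \<le> n" "\<And>i. i \<in> B \<Longrightarrow> finite (T i) \<and> n \<le> card (T i)"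
  shows "\<exists>q. inj_on q (A \<union> B) \<and> (\<forall>i\<in>A. q i = p i) \<and> (\<forall>i\<in>B. q i \<in> T i)"
  using assms
proof (induction B rule: finite_induct)
  case empty
  then show ?case by auto
next
  case (insert x B)
  have card: "card (A \<union> insert x B) = Suc (card (A \<union> B))"
    using insert by (subst Un_insert_right, subst card_insert_disjoint) auto
  with insert obtain q where q: "inj_on q (A \<union> B)" "\<forall>i\<in>A. q i = p i" "\<forall>i\<in>B. q i \<in> T i"
    by auto
  have "card (q ` (A \<union> B)) < card (T x)"
  proof -
    have "card (q ` (A \<union> B)) \<le> card (A \<union> B)" using insert by (intro card_image_le) auto
    also have "\<dots> < n" using insert.prems(4) card by simp
    also have "n \<le> card (T x)" using insert.prems(5)[of x] by simp
    finally show ?thesis .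
  qed
  then obtain t where t: "t \<in> T x" "t \<notin> q ` (A \<union> B)"
    using insert by (meson card_mono finite_UnI finite_imageI linorder_not_le subsetI)
  have x: "x \<notin> A \<union> B" using insert by auto
  define q' where "q' = q(x := t)"
  have "inj_on q' (insert x (A \<union> B))"
    using q(1) t(2) x by (auto simp: inj_on_def q'_def)
  moreover have "q' x = t" and "\<And>i. i \<in> A \<union> B \<Longrightarrow> q' i = q i" using x by (auto simp: q'_def)
  ultimately show ?case using q(2,3) t(1) by (intro exI[of _ q']) simp
qed

text \<open>Partners of vertices with at most \<open>n\<close> neighbours survive truncation; the
  other matched vertices are rematched by \<open>extend_inj\<close>.\<close>

lemma opt_le_opt_trunc:
  assumes "\<And>N. N \<in> set I \<Longrightarrow> finite N"
  shows "opt I \<le> opt (map (trunc (length I)) I)"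
proof -
  let ?n = "length I"
  obtain M where M: "is_matching I M" "card M = opt I" by (rule opt_attained)
  obtain p where p: "inj_on p (fst ` M)" "\<And>i. i \<in> fst ` M \<Longrightarrow> i < ?n \<and> p i \<in> I ! i"
    using is_matching_funD[OF M(1)] by blast
  let ?D = "fst ` M"
  let ?A = "{i \<in> ?D. card (I ! i) \<le> ?n}" and ?B = "{i \<in> ?D. \<not> card (I ! i) \<le> ?n}"
  have AB: "?A \<union> ?B = ?D" by auto
  have fin: "finite ?D" using is_matching_card_le[OF M(1)] by simp
  have card: "card ?D = opt I" using M by (simp add: is_matching_def card_image)
  have "\<exists>q. inj_on q (?A \<union> ?B) \<and> (\<forall>i\<in>?A. q i = p i) \<and> (\<forall>i\<in>?B. q i \<in> trunc ?n (I ! i))"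
  proof (rule extend_inj)
    show "card (?A \<union> ?B) \<le> ?n" unfolding AB card using is_matching_card_le[OF M(1)] M(2) by simp
    show "inj_on p ?A" using p(1) by (rule inj_on_subset) auto
  qed (use fin in \<open>auto simp: card_trunc\<close>)
  then obtain q where q: "inj_on q ?D" "\<And>i. i \<in> ?A \<Longrightarrow> q i = p i" "\<And>i. i \<in> ?B \<Longrightarrow> q i \<in> trunc ?n (I ! i)"
    unfolding AB by blast
  have "card ?D \<le> opt (map (trunc ?n) I)"
  proof (rule card_le_opt_fun[OF q(1)])
    fix i assume i: "i \<in> ?D"
    show "i < length (map (trunc ?n) I) \<and> q i \<in> map (trunc ?n) I ! i"
      using p(2)[OF i] q(2,3)[of i] i trunc_eq[of "I ! i" ?n] assms
      by (cases "card (I ! i) \<le> ?n") auto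
  qed
  then show ?thesis using card by simp
qed

text \<open>An offline vertex is renamed once it first occurs in a truncated neighbourhood, so
  the new name is determined by the past of the online algorithm.\<close>

definition first_occ :: "nat \<Rightarrow> nat set list \<Rightarrow> nat \<Rightarrow> nat" where
  "first_occ n I u = (LEAST i. i < length I \<and> u \<in> trunc n (I ! i))"

text \<open>Pairs the time of first occurrence with the rank inside that truncated neighbourhood.
  The rank is below \<open>n\<close>, so division by \<open>n\<close> recovers the time.\<close>

definition vlabel :: "nat \<Rightarrow> nat set list \<Rightarrow> nat \<Rightarrow> nat" where
  "vlabel n I u = first_occ n I u * n + card {w \<in> trunc n (I ! first_occ n I u). w < u}"

lemma first_occ:
  assumes "j < length I" "u \<in> trunc n (I ! j)"
  shows "first_occ n I u < length I" "u \<in> trunc n (I ! first_occ n I u)" "first_occ n I u \<le> j"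
proof -
  let ?P = "\<lambda>i. i < length I \<and> u \<in> trunc n (I ! i)"
  have "?P (first_occ n I u)" unfolding first_occ_def by (rule LeastI[of ?P j]) (use assms in auto)
  then show "first_occ n I u < length I" "u \<in> trunc n (I ! first_occ n I u)" by auto
  show "first_occ n I u \<le> j" unfolding first_occ_def by (rule Least_le) (use assms in auto)
qed

lemma rank_less:
  assumes "u \<in> trunc n N"
  shows "card {w \<in> trunc n N. w < u} < n"
proof -
  have "card {w \<in> trunc n N. w < u} < card (trunc n N)"
    using assms by (intro psubset_card_mono) auto
  also have "\<dots> \<le> n" by (simp add: card_trunc)
  finally show ?thesis .
qed

lemma vlabel_less:
  assumes "j < length I" "u \<in> trunc n (I ! j)"
  shows "vlabel n I u < length I * n"
proof -
  have "vlabel n I u < Suc (first_occ n I u) * n"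
    using rank_less[OF first_occ(2)[OF assms]] by (simp add: vlabel_def)
  also have "\<dots> \<le> length I * n" using first_occ(1)[OF assms] by (intro mult_le_mono1) simp
  finally show ?thesis .
qed

lemma vlabel_inj:
  assumes "j < length I" "u \<in> trunc n (I ! j)" "k < length I" "v \<in> trunc n (I ! k)"
    and eq: "vlabel n I u = vlabel n I v"
  shows "u = v"
proof -
  note u = first_occ(2)[OF assms(1,2)] and v = first_occ(2)[OF assms(3,4)]
  have occ: "first_occ n I u = vlabel n I u div n" "first_occ n I v = vlabel n I v div n"
    using rank_less[OF u] rank_less[OF v] by (simp_all add: vlabel_def)
  then have same: "first_occ n I u = first_occ n I v" using eq by simp
  let ?N = "trunc n (I ! first_occ n I v)"
  have card: "card {w \<in> ?N. w < u} = card {w \<in> ?N. w < v}"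
    using eq same by (simp add: vlabel_def)
  have less: "card {w \<in> ?N. w < a} < card {w \<in> ?N. w < b}" if "a < b" "a \<in> ?N" for a b
    using that by (intro psubset_card_mono) auto
  show ?thesis using less[of u v] less[of v u] card u v same by (metis nat_neq_iff)
qed

text \<open>A name is settled at the first occurrence and never changes later, so it is available
  online.\<close>

lemma vlabel_take:
  assumes "j < k" "k \<le> length I" "u \<in> trunc n (I ! j)"
  shows "vlabel n (take k I) u = vlabel n I u"
proof -
  have j: "j < length I" using assms by simp
  have "first_occ n (take k I) u = first_occ n I u"
    unfolding first_occ_def[of n "take k I"]
  proof (rule Least_equality)
    show "first_occ n I u < length (take k I) \<and> u \<in> trunc n (take k I ! first_occ n I u)"
      using first_occ[OF j assms(3)] assms by simp
  next
    fix i assume "i < length (take k I) \<and> u \<in> trunc n (take k I ! i)"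
    then show "first_occ n I u \<le> i" using assms by (intro first_occ(3)) auto
  qed
  then show ?thesis using first_occ(3)[OF j assms(3)] assms by (simp add: vlabel_def)
qed

definition labelled :: "nat \<Rightarrow> nat set list \<Rightarrow> nat set list" where
  "labelled n I = map (\<lambda>N. vlabel n I ` trunc n N) I"

lemma length_labelled [simp]: "length (labelled n I) = length I"
  by (simp add: labelled_def)

lemma labelled_nth: "i < length I \<Longrightarrow> labelled n I ! i = vlabel n I ` trunc n (I ! i)"
  by (simp add: labelled_def)

lemma labelled_take:
  assumes "k \<le> length I"
  shows "labelled n (take k I) = take k (labelled n I)"
proof (rule nth_equalityI)
  fix i assume "i < length (labelled n (take k I))"
  then show "labelled n (take k I) ! i = take k (labelled n I) ! i"
    using assms vlabel_take[of i k I _ n] by (simp add: labelled_nth)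
qed simp

lemma labelled_subset: "N \<in> set (labelled n I) \<Longrightarrow> N \<subseteq> {..<length I * n}"
  using vlabel_less by (force simp: labelled_def in_set_conv_nth)

lemma opt_le_opt_labelled:
  assumes "\<And>N. N \<in> set I \<Longrightarrow> finite N"
  shows "opt I \<le> opt (labelled (length I) I)"
proof -
  let ?T = "map (trunc (length I)) I"
  obtain M where M: "is_matching ?T M" "card M = opt ?T" by (rule opt_attained)
  obtain p where p: "inj_on p (fst ` M)" "\<And>i. i \<in> fst ` M \<Longrightarrow> i < length ?T \<and> p i \<in> ?T ! i"
    using is_matching_funD[OF M(1)] by blast
  have "inj_on (\<lambda>i. vlabel (length I) I (p i)) (fst ` M)"
  proof (rule inj_onI)
    fix i j assume ij: "i \<in> fst ` M" "j \<in> fst ` M"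
      and eq: "vlabel (length I) I (p i) = vlabel (length I) I (p j)"
    have "p i = p j"
      by (rule vlabel_inj[OF _ _ _ _ eq, of i j]) (use p(2)[OF ij(1)] p(2)[OF ij(2)] in auto)
    then show "i = j" using p(1) ij by (auto dest: inj_onD)
  qed
  then have "card (fst ` M) \<le> opt (labelled (length I) I)"
  proof (rule card_le_opt_fun)
    fix i assume "i \<in> fst ` M"
    from p(2)[OF this] show "i < length (labelled (length I) I) \<and>
        vlabel (length I) I (p i) \<in> labelled (length I) I ! i"
      by (auto simp: labelled_nth)
  qed
  moreover have "card (fst ` M) = opt ?T" using M by (simp add: is_matching_def card_image)
  ultimately show ?thesis using opt_le_opt_trunc[of I] assms by simp
qed

section \<open>Online simulation of Ranking under canonical names\<close>

text \<open>Ranking is rerun on the renamed past with the current vertex appended. The last entry is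
  the current decision, and \<open>SOME\<close> translates its name back.\<close>

definition ranking_alg :: "nat \<Rightarrow> (nat \<Rightarrow> nat) \<Rightarrow> online_alg" where
  "ranking_alg n y U past N =
     map_option (\<lambda>l. SOME u. u \<in> trunc n N \<and> vlabel n (past @ [N]) u = l)
       (last (ranking y (labelled n (past @ [N])) {..<n * n}))"

text \<open>Downward induction on \<open>k\<close>. The hypothesis on \<open>M\<close> is the
  invariant: on vertices of truncated neighbourhoods, being matched means that the new name has been
  used by the simulated Ranking.\<close>

lemma run_aux_ranking_alg:
  assumes "length I = n" "k \<le> n"
    and "\<And>j u. j < n \<Longrightarrow> u \<in> trunc n (I ! j) \<Longrightarrow>
      u \<in> M \<longleftrightarrow> Some (vlabel n I u) \<in> set (take k (ranking y (labelled n I) {..<n * n}))"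
  shows "run_aux (ranking_alg n y) U (take k I) (drop k I) M =
    card {i. k \<le> i \<and> i < n \<and> ranking y (labelled n I) {..<n * n} ! i \<noteq> None}"
  using assms(2,3)
proof (induction k arbitrary: M rule: inc_induct)
  case base
  then show ?case using assms(1) by simp
next
  case (step k)
  let ?out = "ranking y (labelled n I) {..<n * n}"
  let ?A = "ranking_alg n y U (take k I) (I ! k)"
  have len: "length ?out = n" using assms(1) by simp
  have dropk: "drop k I = I ! k # drop (Suc k) I" and takek: "take k I @ [I ! k] = take (Suc k) I"
    using step assms(1) by (simp_all add: Cons_nth_drop_Suc take_Suc_conv_app_nth)
  have take_out: "take (Suc k) ?out = take k ?out @ [?out ! k]"
    using step len by (simp add: take_Suc_conv_app_nth)
  have A: "?A = map_option (\<lambda>l. SOME u. u \<in> trunc n (I ! k) \<and> vlabel n (take (Suc k) I) u = l) (?out ! k)"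
    using step assms(1) by (simp add: ranking_alg_def takek labelled_take ranking_take take_out)
  show ?case
  proof (cases "?out ! k")
    case None
    have "{i. k \<le> i \<and> i < n \<and> ?out ! i \<noteq> None} = {i. Suc k \<le> i \<and> i < n \<and> ?out ! i \<noteq> None}"
      using None by (auto simp: Suc_le_eq le_less)
    moreover have "run_aux (ranking_alg n y) U (take k I) (drop k I) M =
        run_aux (ranking_alg n y) U (take (Suc k) I) (drop (Suc k) I) M"
      unfolding dropk using A None by (simp add: takek)
    moreover have "run_aux (ranking_alg n y) U (take (Suc k) I) (drop (Suc k) I) M =
        card {i. Suc k \<le> i \<and> i < n \<and> ?out ! i \<noteq> None}"
      by (rule step.IH) (simp add: take_out None step.prems)
    ultimately show ?thesis by simp
  next
    case (Some l)
    define u where "u = (SOME u. u \<in> trunc n (I ! k) \<and> vlabel n (take (Suc k) I) u = l)"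
    have "l \<in> labelled n I ! k"
      using ranking_nth_mem[of "{..<n * n}" k "labelled n I" y l] Some step assms(1) by simp
    then obtain u' where u': "u' \<in> trunc n (I ! k)" "vlabel n I u' = l"
      using step assms(1) by (auto simp: labelled_nth)
    have lab: "vlabel n (take (Suc k) I) v = vlabel n I v" if "v \<in> trunc n (I ! k)" for v
      using step assms(1) that by (intro vlabel_take[of k]) auto
    have u: "u \<in> trunc n (I ! k)" "vlabel n I u = l"
      using someI[of "\<lambda>u. u \<in> trunc n (I ! k) \<and> vlabel n (take (Suc k) I) u = l" u'] u' lab
      unfolding u_def[symmetric] by auto
    \<comment> \<open>Ranking never uses a name twice, so \<open>u\<close> is free in the actual run
      and the proposal is executed.\<close>
    have "Some l \<notin> set (take k ?out)"
      using ranking_nth_inj[of "{..<n * n}" _ k "labelled n I" y l] Some step(2) assms(1)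
      by (auto simp: in_set_conv_nth)
    then have "u \<notin> M" using step.prems[OF step.hyps(2) u(1)] u(2) by simp
    have "{i. k \<le> i \<and> i < n \<and> ?out ! i \<noteq> None} = insert k {i. Suc k \<le> i \<and> i < n \<and> ?out ! i \<noteq> None}"
      using Some step by (auto simp: Suc_le_eq le_less)
    then have "card {i. k \<le> i \<and> i < n \<and> ?out ! i \<noteq> None} = Suc (card {i. Suc k \<le> i \<and> i < n \<and> ?out ! i \<noteq> None})"
      by simp
    moreover have "run_aux (ranking_alg n y) U (take k I) (drop k I) M =
        Suc (run_aux (ranking_alg n y) U (take (Suc k) I) (drop (Suc k) I) (insert u M))"
      unfolding dropk using A Some u(1) trunc_subset \<open>u \<notin> M\<close> by (auto simp: takek u_def[symmetric])
    moreover have "run_aux (ranking_alg n y) U (take (Suc k) I) (drop (Suc k) I) (insert u M) =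
        card {i. Suc k \<le> i \<and> i < n \<and> ?out ! i \<noteq> None}"
    proof (rule step.IH)
      fix j v assume v: "j < n" "v \<in> trunc n (I ! j)"
      \<comment> \<open>Injectivity of the names carries the invariant over to
        \<open>insert u M\<close>.\<close>
      have "v = u \<longleftrightarrow> vlabel n I v = l"
        using vlabel_inj[of j I v n k u] v u step(2) assms(1) by auto
      then show "v \<in> insert u M \<longleftrightarrow> Some (vlabel n I v) \<in> set (take (Suc k) ?out)"
        using step.prems[OF v] by (auto simp: take_out Some)
    qed
    ultimately show ?thesis by simp
  qed
qed

lemma alg_value_ranking_alg:
  "alg_value (ranking_alg (length I) y) U I =
    rank_value y (labelled (length I) I) {..<length I * length I}"
  using run_aux_ranking_alg[of I "length I" 0 "{}" y U]
  by (simp add: alg_value_def rank_value_def)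

section \<open>The polynomial family of algorithms\<close>

text \<open>There are \<open>2 ^ (n ^ 3)\<close> lists of \<open>n\<close> subsets of
  \<open>{..<n * n}\<close>, and after \<open>C * (n ^ 3 + 1)\<close> greedy choices fewer than one
  of them can remain unhit.\<close>

lemma exists_hitting_seeds:
  fixes \<delta> :: real
  assumes "L > 0" "0 < \<delta>" "\<delta> \<le> 1" "1 \<le> \<delta> * real C"
  shows "\<exists>ys. length ys = C * (n ^ 3 + 1) \<and>
    (\<forall>J. length J = n \<longrightarrow> (\<forall>N\<in>set J. N \<subseteq> {..<n * n}) \<longrightarrow>
      (\<exists>y\<in>set ys. (ranking_ratio L - \<delta>) * real (opt J) \<le> real (rank_value y J {..<n * n})))"
proof -
  define X where "X = {J. set J \<subseteq> Pow {..<n * n} \<and> length J = n}"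
  define good where "good = (\<lambda>J y. (ranking_ratio L - \<delta>) * real (opt J) \<le> real (rank_value y J {..<n * n}))"
  define k where "k = C * (n ^ 3 + 1)"
  have finX: "finite X" unfolding X_def by (rule finite_lists_length_eq) simp
  have "card X = (2 ^ (n * n)) ^ n" unfolding X_def
    by (subst card_lists_length_eq) (simp_all add: card_Pow)
  also have "\<dots> = 2 ^ (n ^ 3)" by (simp add: power3_eq_cube flip: power_mult)
  finally have cardX: "real (card X) = 2 ^ (n ^ 3)" by simp
  have dense: "\<delta> * real (card (seeds (n * n) L)) \<le> real (card {y \<in> seeds (n * n) L. good J y})"
    if "J \<in> X" for J
    unfolding good_def by (rule card_good_seeds_ge) (use that assms in \<open>auto simp: X_def\<close>)
  obtain ys where ys: "length ys = k"
    "real (card {J \<in> X. \<forall>y\<in>set ys. \<not> good J y}) \<le> (1 - \<delta>) ^ k * real (card X)"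
    using exists_hitting_list[where good = good and k = k,
        OF finX finite_seeds seeds_nonempty[OF assms(1)] assms(3) dense] by blast
  note ys(2)
  \<comment> \<open>Uses \<open>1 - \<delta> \<le> exp (- \<delta>)\<close> and
    \<open>2 \<le> exp 1\<close>; with \<open>1 \<le> \<delta> * real C\<close> the product is at
    most \<open>exp (-1)\<close>.\<close>
  also have "(1 - \<delta>) ^ k * real (card X) \<le> exp (- \<delta>) ^ k * exp 1 ^ (n ^ 3)"
    unfolding cardX using assms exp_ge_add_one_self[of "- \<delta>"] exp_ge_add_one_self[of 1]
    by (intro mult_mono power_mono) auto
  also have "\<dots> = exp (real (n ^ 3) - (\<delta> * real C) * real (n ^ 3 + 1))"
    by (simp add: k_def algebra_simps flip: exp_of_nat_mult exp_add)
  also have "\<dots> \<le> exp (real (n ^ 3) - 1 * real (n ^ 3 + 1))"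
    using assms(4) by (subst exp_le_cancel_iff, intro diff_left_mono mult_right_mono) auto
  also have "\<dots> < 1" by simp
  finally have "card {J \<in> X. \<forall>y\<in>set ys. \<not> good J y} = 0" by simp
  then have "{J \<in> X. \<forall>y\<in>set ys. \<not> good J y} = {}" using finX by simp
  then have "\<exists>y\<in>set ys. good J y" if "J \<in> X" for J using that by blast
  then show ?thesis using ys(1) unfolding k_def X_def good_def by (intro exI[of _ ys]) auto
qed

lemma ranking_ratio_tendsto: "ranking_ratio \<longlonglongrightarrow> 1 - exp (-1)"
proof -
  have "(\<lambda>L. 1 - 1 / (1 + 1 / real L) ^ L) \<longlonglongrightarrow> 1 - 1 / exp 1"
    by (intro tendsto_intros tendsto_exp_limit_sequentially) simp
  moreover have "ranking_ratio = (\<lambda>L. 1 - 1 / (1 + 1 / real L) ^ L)"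
    by (simp add: fun_eq_iff ranking_ratio_def gain_def)
  ultimately show ?thesis by (simp add: exp_minus inverse_eq_divide)
qed

lemma exists_polynomial_max_of_alg:
  fixes \<epsilon> :: real
  assumes "\<epsilon> > 0"
  shows "\<exists>algs :: max_of_alg. (\<exists>d::nat. (\<lambda>n. real (length (algs n))) \<in> O(\<lambda>n. real n ^ d)) \<and>
    approx_ratio algs \<ge> 1 - exp (-1) - \<epsilon>"
proof -
  \<comment> \<open>Half of \<open>\<epsilon>\<close> pays for the distance of
    \<open>ranking_ratio L\<close> from its limit, the other half for
    \<open>\<delta>\<close>.\<close>
  define \<delta> where "\<delta> = min 1 (\<epsilon> / 2)"
  have \<delta>: "0 < \<delta>" "\<delta> \<le> 1" "\<delta> \<le> \<epsilon> / 2" using assms by (auto simp: \<delta>_def)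
  have "eventually (\<lambda>L. ranking_ratio L > 1 - exp (-1) - \<epsilon> / 2) sequentially"
    by (rule order_tendstoD(1)[OF ranking_ratio_tendsto]) (use assms in simp)
  with eventually_gt_at_top[of 0] have "eventually (\<lambda>L. 0 < L \<and> ranking_ratio L > 1 - exp (-1) - \<epsilon> / 2) sequentially"
    by eventually_elim simp
  then obtain L where L: "0 < L" "ranking_ratio L > 1 - exp (-1) - \<epsilon> / 2"
    by (auto dest: eventually_happens)
  define C where "C = nat \<lceil>1 / \<delta>\<rceil>"
  have "1 / \<delta> \<le> real C" unfolding C_def by linarith
  then have C: "1 \<le> \<delta> * real C" using \<delta> by (simp add: field_simps)
  obtain ys where ys: "\<And>n. length (ys n) = C * (n ^ 3 + 1)"
    "\<And>n J. length J = n \<Longrightarrow> \<forall>N\<in>set J. N \<subseteq> {..<n * n} \<Longrightarrow>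
      \<exists>y\<in>set (ys n). (ranking_ratio L - \<delta>) * real (opt J) \<le> real (rank_value y J {..<n * n})"
    using exists_hitting_seeds[OF L(1) \<delta>(1,2) C] by metis
  define algs where "algs = (\<lambda>n. map (ranking_alg n) (ys n))"
  have "(\<lambda>n. real (length (algs n))) \<in> O(\<lambda>n. real n ^ 3)"
  proof (rule bigoI)
    show "eventually (\<lambda>n. norm (real (length (algs n))) \<le> (2 * real C) * norm (real n ^ 3)) sequentially"
      using eventually_ge_at_top[of 1]
    proof eventually_elim
      case (elim n)
      then have "1 \<le> real n ^ 3" by (simp add: one_le_power)
      then have "real C * 1 \<le> real C * real n ^ 3" by (intro mult_left_mono) auto
      then show ?case by (simp add: algs_def ys(1) algebra_simps)
    qed
  qed
  moreover have "1 - exp (-1) - \<epsilon> \<le> approx_ratio algs"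
  proof (rule approx_ratio_ge)
    fix U I assume valid: "valid_instance U I" and "opt I > 0"
    define n where "n = length I"
    let ?J = "labelled n I"
    have le: "opt I \<le> opt ?J" unfolding n_def
      by (rule opt_le_opt_labelled) (use valid in \<open>auto simp: valid_instance_def intro: finite_subset\<close>)
    have "\<exists>y\<in>set (ys n). (ranking_ratio L - \<delta>) * real (opt ?J) \<le> real (rank_value y ?J {..<n * n})"
      by (rule ys(2)) (use labelled_subset[of _ n I] n_def in auto)
    then obtain y where y: "y \<in> set (ys n)"
      "(ranking_ratio L - \<delta>) * real (opt ?J) \<le> real (rank_value y ?J {..<n * n})" by blast
    have "rank_value y ?J {..<n * n} = alg_value (ranking_alg n y) U I"
      unfolding n_def by (rule alg_value_ranking_alg[symmetric])
    also have "\<dots> \<le> max_value algs U I"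
      unfolding max_value_def n_def[symmetric] using y(1) by (intro Max_ge) (auto simp: algs_def)
    finally have *: "(ranking_ratio L - \<delta>) * real (opt ?J) \<le> real (max_value algs U I)"
      using y(2) by linarith
    show "(1 - exp (-1) - \<epsilon>) * real (opt I) \<le> real (max_value algs U I)"
    \<comment> \<open>Passing from \<open>opt I\<close> to the larger \<open>opt ?J\<close> needs a
      nonnegative factor; otherwise the bound is trivial.\<close>
    proof (cases "1 - exp (-1) - \<epsilon> \<le> 0")
      case True
      then have "(1 - exp (-1) - \<epsilon>) * real (opt I) \<le> 0" by (simp add: mult_nonpos_nonneg)
      then show ?thesis by (rule order_trans) simp
    next
      case False
      have "(1 - exp (-1) - \<epsilon>) * real (opt I) \<le> (ranking_ratio L - \<delta>) * real (opt ?J)"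
        using False le L(2) \<delta>(3) by (intro mult_mono) auto
      with * show ?thesis by linarith
    qed
  qed
  ultimately show ?thesis by blast
qed

theorem theorem5:
  shows "(\<forall>\<epsilon>::real. \<epsilon> > 0 \<longrightarrow>
            (\<exists>algs :: max_of_alg.
               (\<exists>d::nat. (\<lambda>n. real (length (algs n))) \<in> O(\<lambda>n. real n ^ d)) \<and>
               approx_ratio algs \<ge> 1 - exp (-1) - \<epsilon>))
       \<and> (\<forall>\<epsilon>::real. \<epsilon> > 0 \<longrightarrow>
            (\<forall>algs :: max_of_alg.
               (\<exists>f :: nat \<Rightarrow> real. f \<in> o(\<lambda>n. real n) \<and>
                   (\<forall>n. real (length (algs n)) \<le> 2 powr f n)) \<longrightarrow>
               approx_ratio algs \<le> 1 - exp (-1) + \<epsilon>))"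
  using exists_polynomial_max_of_alg approx_ratio_le_of_subexponential by blast

end
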